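(* Let $X$ and $Y$ be Banach spaces and let $\Omega$ be a compact Hausdorff space with Borel $\sigma$-algebra $\Sigma$. Assume that $S\in\mathcal{L}(\mathcal{C}(\Omega),\mathcal{L}(X,Y))$ and let $m:\Sigma\rightarrow\mathcal{L}(X,Y^{**})$ be its representing measure. Let $1\leq p\leq\infty$. If there exists an operator $U\in\mathcal{L}(\mathcal{C}_{p}(\Omega,X),Y)$ such that $U^{\#}=S$, then there exists a constant $c>0$ such that, for every sequence $(E_{i})$ of pairwise disjoint sets in $\Sigma$ and every sequence $(x_{i})$ in $B_{X}$, the inequality $\|(m(E_{i})x_{i})\|_{p'}^{w}\leq c$ holds.
   Context: All Banach spaces are over the same field $\mathbb{K}$ ($\mathbb{R}$ or $\mathbb{C}$); $B_X$ is the closed unit ball of $X$; $\mathcal{L}(X,Y)$ is the Banach space of bounded linear operators; $p'$ is the conjugate index, $1/p+1/p'=1$ with $1/\infty=0$. For a sequence $(w_i)$ in a Banach space $W$, $\|(w_i)\|_q^w=\sup_{w^*\in B_{W^*}}(\sum_i|w^*(w_i)|^q)^{1/q}$ (supremum if $q=\infty$). $\mathcal{C}(\Omega)$ and $\mathcal{C}(\Omega,X)$ are the spaces of continuous $\mathbb{K}$-valued and $X$-valued functions on $\Omega$ with the supremum norm. $\mathcal{C}_p(\Omega,X)$, the Banach space of $p$-continuous $X$-valued functions, consists of all $f\in\mathcal{C}(\Omega,X)$ for which there is a sequence $(x_n)\in\ell_p(X)$ (or $(x_n)\in c_0(X)$ when $p=\infty$) with $f(\Omega)\subset\{\sum_n\alpha_nx_n:(\alpha_n)\in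 B_{\ell_{p'}}\}$; its norm is $\inf\|(x_n)\|_p$ over all such sequences. It is known that $\mathcal{C}_p(\Omega,X)=\mathcal{C}(\Omega)\hat{\otimes}_{d_p}X$ as Banach spaces via $\varphi x\leftrightarrow\varphi\otimes x$, where $\varphi x$ is the function $\omega\mapsto\varphi(\omega)x$ and $d_p$ is the right Chevet--Saphar tensor norm: for $u\in Z\otimes X$, $d_p(u)=\inf\{\|(z_i)\|_{p'}^w\,\|(x_i)\|_p: u=\sum_{i=1}^n z_i\otimes x_i\}$. For $U\in\mathcal{L}(\mathcal{C}_p(\Omega,X),Y)$, the associated operator is $(U^{\#}\varphi)x=U(\varphi x)$. Representing measure: for $T\in\mathcal{L}(\mathcal{C}(\Omega),Y)$, its (classical) representing measure is the finitely additive vector measure $\Sigma\to Y^{**}$, $E\mapsto T^{**}(\chi_E)$, where the bounded Borel function $\chi_E$ is viewed as an element of $\mathcal{C}(\Omega)^{**}$ by integration against the regular Borel measures $\mathcal{C}(\Omega)^*$; it satisfies $T\varphi=\int_\Omega\varphi\,dm$ for $\varphi\in\mathcal{C}(\Omega)$. For $S\in\mathcal{L}(\mathcal{C}(\Omega),\mathcal{L}(X,Y))$ and $x\in X$, let $S_x\in\mathcal{L}(\mathcal{C}(\Omega),Y)$ be $S_x\varphi=(S\varphi)x$, with representing measure $m_x:\Sigma\to Y^{**}$. The representing measure $m:\Sigma\to\mathcal{L}(X,Y^{**})$ of $S$ is the finitely additive measure defined by $m(E)x=m_x(E)$, $E\in\Sigma$, $x\in X$. *)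

theory Defs
  imports "HOL-Analysis.Analysis"
begin

text \<open>The scalar field is the real or the complex field.  Both cases are treated at once by a
  type class that has exactly these two models up to isometric isomorphism.\<close>

class rc_field = real_normed_field +
  assumes real_or_complex:
    "(\<forall>z. \<exists>a. z = a *\<^sub>R 1) \<or>
     (\<exists>i. i * i = - 1 \<and> (\<forall>z. \<exists>a b. z = a *\<^sub>R 1 + b *\<^sub>R i) \<and>
          (\<forall>a b. norm (a *\<^sub>R 1 + b *\<^sub>R i) = sqrt (a\<^sup>2 + b\<^sup>2)))"

instance real :: rc_field
  by standard auto

instance complex :: rc_field
proof
  have "\<i> * \<i> = - 1 \<and> (\<forall>z. \<exists>a b. z = a *\<^sub>R 1 + b *\<^sub>R \<i>) \<and>
        (\<forall>a b. norm (a *\<^sub>R 1 + b *\<^sub>R \<i>) = sqrt (a\<^sup>2 + b\<^sup>2))"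
  proof (intro conjI allI)
    fix z show "\<exists>a b. z = a *\<^sub>R 1 + b *\<^sub>R \<i>"
      by (rule exI[of _ "Re z"], rule exI[of _ "Im z"]) (simp add: complex_eq_iff)
  qed (simp_all add: cmod_def)
  then show "(\<forall>z::complex. \<exists>a. z = a *\<^sub>R 1) \<or>
     (\<exists>i::complex. i * i = - 1 \<and> (\<forall>z. \<exists>a b. z = a *\<^sub>R 1 + b *\<^sub>R i) \<and>
          (\<forall>a b. norm (a *\<^sub>R 1 + b *\<^sub>R i) = sqrt (a\<^sup>2 + b\<^sup>2)))"
    by blast
qed

text \<open>A Banach space over the scalar field \<open>'k\<close> is a real Banach space with a compatible
  multiplication by scalars from \<open>'k\<close>.\<close>

locale banach_over = vector_space scale
  for scale :: "'k::rc_field \<Rightarrow> 'a::banach \<Rightarrow> 'a" +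
  assumes scale_of_real: "scale (of_real r) x = r *\<^sub>R x"
    and norm_scale: "norm (scale c x) = norm c * norm x"

text \<open>Duals, operator spaces and the space of \<open>p\<close>-continuous functions are handled as normed
  spaces with an explicit carrier, since linearity over \<open>'k\<close> is not visible in their types and
  the last one does not carry the norm of its ambient type.\<close>

record ('k, 'v) nspace =
  vset :: "'v set"
  vadd :: "'v \<Rightarrow> 'v \<Rightarrow> 'v"
  vscale :: "'k \<Rightarrow> 'v \<Rightarrow> 'v"
  vnorm :: "'v \<Rightarrow> real"

definition type_space :: "('k::rc_field \<Rightarrow> 'a::real_normed_vector \<Rightarrow> 'a) \<Rightarrow> ('k, 'a) nspace" where
  "type_space s = \<lparr>vset = UNIV, vadd = (+), vscale = s, vnorm = norm\<rparr>"

definition unit_ball :: "('k, 'v) nspace \<Rightarrow> 'v set" where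
  "unit_ball V = {v \<in> vset V. vnorm V v \<le> 1}"

text \<open>The space of bounded linear operators with the operator norm; operators are
  \<open>undefined\<close> off the carrier of their domain.\<close>

definition op_space :: "('k, 'v) nspace \<Rightarrow> ('k, 'w) nspace \<Rightarrow> ('k, 'v \<Rightarrow> 'w) nspace" where
  "op_space V W = \<lparr>
     vset = {T \<in> vset V \<rightarrow>\<^sub>E vset W.
       (\<forall>u\<in>vset V. \<forall>v\<in>vset V. T (vadd V u v) = vadd W (T u) (T v)) \<and>
       (\<forall>c. \<forall>v\<in>vset V. T (vscale V c v) = vscale W c (T v)) \<and>
       (\<exists>B. \<forall>v\<in>vset V. vnorm W (T v) \<le> B * vnorm V v)},
     vadd = (\<lambda>T R. \<lambda>v\<in>vset V. vadd W (T v) (R v)),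
     vscale = (\<lambda>c T. \<lambda>v\<in>vset V. vscale W c (T v)),
     vnorm = (\<lambda>T. SUP v\<in>unit_ball V. vnorm W (T v))\<rparr>"

definition dual :: "('k::rc_field, 'v) nspace \<Rightarrow> ('k, 'v \<Rightarrow> 'k) nspace" where
  "dual V = op_space V (type_space (*))"

definition adjoint_op ::
  "('k::rc_field, 'v) nspace \<Rightarrow> ('k, 'w) nspace \<Rightarrow> ('v \<Rightarrow> 'w) \<Rightarrow> ('w \<Rightarrow> 'k) \<Rightarrow> ('v \<Rightarrow> 'k)" where
  "adjoint_op V W T = (\<lambda>f\<in>vset (dual W). \<lambda>v\<in>vset V. f (T v))"

definition biadjoint_op ::
  "('k::rc_field, 'v) nspace \<Rightarrow> ('k, 'w) nspace \<Rightarrow> ('v \<Rightarrow> 'w) \<Rightarrow>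
   (('v \<Rightarrow> 'k) \<Rightarrow> 'k) \<Rightarrow> (('w \<Rightarrow> 'k) \<Rightarrow> 'k)" where
  "biadjoint_op V W T = adjoint_op (dual W) (dual V) (adjoint_op V W T)"

text \<open>Exponents range over \<open>[1, \<infinity>]\<close> inside the type of extended nonnegative reals, in which
  \<open>inverse 0 = \<infinity>\<close> and \<open>inverse \<infinity> = 0\<close>.\<close>

definition conj_exp :: "ennreal \<Rightarrow> ennreal" where
  "conj_exp p = inverse (1 - inverse p)"

lemma conj_exp:
  assumes "1 \<le> p"
  shows "inverse p + inverse (conj_exp p) = 1"
proof -
  have "inverse p \<le> 1"
    using assms by (cases p) (auto simp: inverse_ennreal inverse_le_1_iff)
  moreover have "inverse (inverse q) = q" for q :: ennreal
  proof (cases q)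
    case (real r)
    then show ?thesis by (cases "r = 0") (auto simp: inverse_ennreal)
  qed simp
  ultimately show ?thesis
    by (simp add: conj_exp_def)
qed

definition lp_norm :: "ennreal \<Rightarrow> (nat \<Rightarrow> 'a::real_normed_vector) \<Rightarrow> ennreal" where
  "lp_norm p x =
     (if p = \<infinity> then (SUP n. ennreal (norm (x n)))
      else if summable (\<lambda>n. norm (x n) powr enn2real p)
      then ennreal ((\<Sum>n. norm (x n) powr enn2real p) powr (1 / enn2real p))
      else \<infinity>)"

definition weak_lp_norm :: "ennreal \<Rightarrow> ('k::rc_field, 'v) nspace \<Rightarrow> (nat \<Rightarrow> 'v) \<Rightarrow> ennreal" where
  "weak_lp_norm q W w = (SUP f\<in>unit_ball (dual W). lp_norm q (\<lambda>i. f (w i)))"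

text \<open>Spaces of continuous functions on the compact space \<open>'o\<close>, on which every continuous function
  is bounded.\<close>

definition C_space ::
  "('k::rc_field \<Rightarrow> 'a::real_normed_vector \<Rightarrow> 'a) \<Rightarrow> ('k, 'o::topological_space \<Rightarrow>\<^sub>C 'a) nspace" where
  "C_space s = \<lparr>vset = UNIV, vadd = (+),
     vscale = (\<lambda>c f. Bcontfun (\<lambda>\<omega>. s c (apply_bcontfun f \<omega>))), vnorm = norm\<rparr>"

definition p_null_sequences :: "ennreal \<Rightarrow> (nat \<Rightarrow> 'a::real_normed_vector) set" where
  "p_null_sequences p = {x. lp_norm p x < \<infinity> \<and> (p = \<infinity> \<longrightarrow> x \<longlonglongrightarrow> 0)}"

definition p_hull ::
  "('k::rc_field \<Rightarrow> 'a::real_normed_vector \<Rightarrow> 'a) \<Rightarrow> ennreal \<Rightarrow> (nat \<Rightarrow> 'a) \<Rightarrow> 'a set" where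
  "p_hull s p x = {v. \<exists>\<alpha>. lp_norm (conj_exp p) \<alpha> \<le> 1 \<and> (\<lambda>n. s (\<alpha> n) (x n)) sums v}"

definition Cp_witnesses ::
  "('k::rc_field \<Rightarrow> 'a::real_normed_vector \<Rightarrow> 'a) \<Rightarrow> ennreal \<Rightarrow> ('o::topological_space \<Rightarrow>\<^sub>C 'a) \<Rightarrow>
   (nat \<Rightarrow> 'a) set" where
  "Cp_witnesses s p f = {x \<in> p_null_sequences p. range (apply_bcontfun f) \<subseteq> p_hull s p x}"

definition Cp_space ::
  "('k::rc_field \<Rightarrow> 'a::real_normed_vector \<Rightarrow> 'a) \<Rightarrow> ennreal \<Rightarrow>
   ('k, 'o::topological_space \<Rightarrow>\<^sub>C 'a) nspace" where
  "Cp_space s p = \<lparr>vset = {f. Cp_witnesses s p f \<noteq> {}}, vadd = vadd (C_space s),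
     vscale = vscale (C_space s),
     vnorm = (\<lambda>f. enn2real (INF x\<in>Cp_witnesses s p f. lp_norm p x))\<rparr>"

text \<open>The function \<open>\<omega> \<mapsto> \<phi>(\<omega>) x\<close>, and the operator associated with an operator on
  \<open>p\<close>-continuous functions.\<close>

definition fun_times_vec ::
  "('k::rc_field \<Rightarrow> 'a::real_normed_vector \<Rightarrow> 'a) \<Rightarrow> ('o::topological_space \<Rightarrow>\<^sub>C 'k) \<Rightarrow> 'a \<Rightarrow>
   ('o \<Rightarrow>\<^sub>C 'a)" where
  "fun_times_vec s \<phi> x = Bcontfun (\<lambda>\<omega>. s (apply_bcontfun \<phi> \<omega>) x)"

definition assoc_op ::
  "('k::rc_field \<Rightarrow> 'a::real_normed_vector \<Rightarrow> 'a) \<Rightarrow> (('o::topological_space \<Rightarrow>\<^sub>C 'a) \<Rightarrow> 'b) \<Rightarrow>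
   ('o \<Rightarrow>\<^sub>C 'k) \<Rightarrow> 'a \<Rightarrow> 'b" where
  "assoc_op s U = (\<lambda>\<phi> x. U (fun_times_vec s \<phi> x))"

text \<open>Scalar-valued regular Borel measures.  Such a measure is regular if its total variation is;
  finiteness of the total variation is automatic for countably additive scalar measures.\<close>

definition total_variation ::
  "('o::topological_space set \<Rightarrow> 'k::rc_field) \<Rightarrow> 'o set \<Rightarrow> ennreal" where
  "total_variation \<mu> E =
     (SUP P\<in>{P. finite P \<and> disjoint P \<and> P \<subseteq> sets borel \<and> \<Union>P = E}. \<Sum>A\<in>P. ennreal (norm (\<mu> A)))"

definition regular_borel_measure :: "('o::topological_space set \<Rightarrow> 'k::rc_field) \<Rightarrow> bool" where
  "regular_borel_measure \<mu> \<longleftrightarrow>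
     (\<forall>A. range A \<subseteq> sets borel \<and> disjoint_family A \<longrightarrow> (\<lambda>n::nat. \<mu> (A n)) sums \<mu> (\<Union>n. A n)) \<and>
     total_variation \<mu> UNIV < \<infinity> \<and>
     (\<forall>E\<in>sets borel. \<forall>\<epsilon>>0. \<exists>F G. compact F \<and> open G \<and> F \<subseteq> E \<and> E \<subseteq> G \<and>
        total_variation \<mu> (G - F) < \<epsilon>)"

text \<open>Integration of a bounded Borel function against such a measure, by uniform approximation with
  simple functions.\<close>

definition simple_int :: "('o::topological_space set \<Rightarrow> 'k::rc_field) \<Rightarrow> ('o \<Rightarrow> 'k) \<Rightarrow> 'k" where
  "simple_int \<mu> g = (\<Sum>v\<in>range g. v * \<mu> (g -` {v}))"

definition has_measure_integral ::
  "('o::topological_space set \<Rightarrow> 'k::rc_field) \<Rightarrow> ('o \<Rightarrow> 'k) \<Rightarrow> 'k \<Rightarrow> bool" where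
  "has_measure_integral \<mu> g I \<longleftrightarrow>
     (\<exists>h. (\<forall>n. simple_function borel (h n)) \<and> uniform_limit UNIV h g sequentially \<and>
          (\<lambda>n. simple_int \<mu> (h n)) \<longlonglongrightarrow> I)"

text \<open>\<open>\<xi>\<close> is the characteristic function of \<open>E\<close> viewed as an element of the bidual of the space of
  continuous functions: it acts on a functional by integrating against the regular Borel
  measure that represents this functional by the Riesz theorem.\<close>

definition char_bidual ::
  "'o::topological_space set \<Rightarrow> ((('o \<Rightarrow>\<^sub>C 'k::rc_field) \<Rightarrow> 'k) \<Rightarrow> 'k) \<Rightarrow> bool" where
  "char_bidual E \<xi> \<longleftrightarrow>
     \<xi> \<in> vset (dual (dual (C_space (*)))) \<and>
     (\<forall>l\<in>vset (dual (C_space (*))). \<exists>\<mu>. regular_borel_measure \<mu> \<and>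
        (\<forall>\<phi>. has_measure_integral \<mu> (apply_bcontfun \<phi>) (l \<phi>)) \<and>
        has_measure_integral \<mu> (indicator E) (\<xi> l))"

text \<open>The classical representing measure of an operator on scalar continuous functions, and the
  representing measure of an operator with values in an operator space.\<close>

definition classical_representing_measure ::
  "('k::rc_field \<Rightarrow> 'b::real_normed_vector \<Rightarrow> 'b) \<Rightarrow> (('o::topological_space \<Rightarrow>\<^sub>C 'k) \<Rightarrow> 'b) \<Rightarrow>
   ('o set \<Rightarrow> ('b \<Rightarrow> 'k) \<Rightarrow> 'k) \<Rightarrow> bool" where
  "classical_representing_measure sY T m \<longleftrightarrow>
     (\<forall>E\<in>sets borel. \<exists>\<xi>. char_bidual E \<xi> \<and>
        m E = biadjoint_op (C_space (*)) (type_space sY) T \<xi>)"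

definition representing_measure ::
  "('k::rc_field \<Rightarrow> 'b::real_normed_vector \<Rightarrow> 'b) \<Rightarrow>
   (('o::topological_space \<Rightarrow>\<^sub>C 'k) \<Rightarrow> 'a \<Rightarrow> 'b) \<Rightarrow>
   ('o set \<Rightarrow> 'a \<Rightarrow> ('b \<Rightarrow> 'k) \<Rightarrow> 'k) \<Rightarrow> bool" where
  "representing_measure sY S m \<longleftrightarrow>
     (\<forall>x. classical_representing_measure sY (\<lambda>\<phi>. S \<phi> x) (\<lambda>E. m E x))"

end

theory Submission
  imports Defs
begin

text \<open>By \<open>\<ell>\<^sub>p\<close>-\<open>\<ell>\<^sub>p'\<close> duality and testing against functionals \<open>y\<close> in the unit ball of \<open>Y\<^sup>*\<close>, it
  suffices to bound the finite sums \<open>\<Sum>i<n. \<beta> i * m (E i) (x i) y\<close> with \<open>\<beta>\<close> in the unit ball of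
  \<open>\<ell>\<^sub>p\<close>.  Each \<open>m (E i) (x i) y\<close> is the measure of \<open>E i\<close> under a regular measure \<open>\<mu> i\<close> that
  represents \<open>\<phi> \<mapsto> y (U (\<phi> x\<^sub>i))\<close>.  Regularity and Urysohn's lemma replace the indicator functions
  of the disjoint sets \<open>E i\<close> by continuous functions \<open>\<Phi> i\<close> into \<open>[0, 1]\<close> with disjoint supports,
  so the sum is approximately \<open>y (U f)\<close> for \<open>f = \<Sum>i<n. \<Phi> i (\<beta> i x\<^sub>i)\<close>.  The sequence
  \<open>(\<beta> i x\<^sub>i)\<close> itself witnesses that \<open>f\<close> has norm at most \<open>1\<close> among the \<open>p\<close>-continuous functions.\<close>

subsection \<open>Norms of sequences and duality\<close>

lemma lp_norm_mono:
  assumes "\<And>i. norm (z i) \<le> norm (w i)"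
  shows "lp_norm p z \<le> lp_norm p w"
proof (cases "p = \<infinity>")
  case True
  then show ?thesis
    unfolding lp_norm_def using assms by (auto intro!: SUP_mono ennreal_leI)
next
  case False
  define r where "r = enn2real p"
  have le: "norm (z i) powr r \<le> norm (w i) powr r" for i
    using assms by (intro powr_mono2) (auto simp: r_def)
  show ?thesis
  proof (cases "summable (\<lambda>n. norm (w n) powr r)")
    case True
    then have s: "summable (\<lambda>n. norm (z n) powr r)"
      by (rule summable_comparison_test') (use le in auto)
    have "(\<Sum>n. norm (z n) powr r) \<le> (\<Sum>n. norm (w n) powr r)"
      by (intro suminf_le le s True)
    then show ?thesis
      using s True False
      by (auto simp: lp_norm_def r_def intro!: ennreal_leI powr_mono2 suminf_nonneg)
  qed (use False in \<open>auto simp: lp_norm_def r_def\<close>)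
qed

lemma lp_norm_finite_support:
  assumes "p \<noteq> \<infinity>" "\<And>i. i \<ge> n \<Longrightarrow> z i = 0"
  shows "lp_norm p z = ennreal ((\<Sum>i<n. norm (z i) powr enn2real p) powr (1 / enn2real p))"
proof -
  have "(\<lambda>i. norm (z i) powr enn2real p) sums (\<Sum>i<n. norm (z i) powr enn2real p)"
    by (rule sums_finite) (use assms in \<open>auto simp: not_less\<close>)
  then show ?thesis
    using assms(1) by (auto simp: lp_norm_def sums_iff)
qed

text \<open>The pointwise bound settles the supremum norm and the bound on the power sum settles
  finite exponents, so membership in the unit ball can be checked for all exponents at once.\<close>

lemma lp_norm_finite_support_le_1:
  assumes "\<And>i. i \<ge> n \<Longrightarrow> z i = 0"
    and "\<And>i. norm (z i) \<le> 1"
    and "p \<noteq> \<infinity> \<Longrightarrow> (\<Sum>i<n. norm (z i) powr enn2real p) \<le> 1"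
  shows "lp_norm p z \<le> 1"
proof (cases "p = \<infinity>")
  case True
  then show ?thesis
    using assms(2) by (auto simp: lp_norm_def intro!: SUP_least)
next
  case False
  then show ?thesis
    using assms by (simp add: lp_norm_finite_support[of p n] powr_le1 sum_nonneg)
qed

text \<open>A single entry has the same norm for every exponent. This covers unit vectors and,
  later, the values at one point of functions that are never nonzero together.\<close>

lemma lp_norm_single_term_le_1:
  assumes "\<And>i. norm (z i) \<le> 1" and "\<And>i j. z i \<noteq> 0 \<Longrightarrow> z j \<noteq> 0 \<Longrightarrow> i = j"
  shows "lp_norm p z \<le> 1"
proof (cases "\<exists>k. z k \<noteq> 0")
  case True
  then obtain k where k: "z k \<noteq> 0" by blast
  have z: "z i = 0" if "i \<noteq> k" for i using assms(2) k that by blast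
  show ?thesis
  proof (rule lp_norm_finite_support_le_1[where n = "Suc k"])
    have "(\<Sum>i<Suc k. norm (z i) powr enn2real p) = norm (z k) powr enn2real p"
      using z by (simp add: sum.neutral)
    then show "(\<Sum>i<Suc k. norm (z i) powr enn2real p) \<le> 1"
      using assms(1)[of k] by (simp add: powr_le1)
  qed (use z assms in auto)
next
  case False
  then show ?thesis
    by (intro lp_norm_finite_support_le_1[where n = 0]) (auto simp: assms)
qed

lemma conj_exp_1 [simp]: "conj_exp 1 = \<infinity>"
  and conj_exp_top [simp]: "conj_exp top = 1"
  by (simp_all add: conj_exp_def)

lemma conj_exp_ennreal:
  assumes "1 < r"
  shows "conj_exp (ennreal r) = ennreal (r / (r - 1))"
proof -
  have "1 - inverse (ennreal r) = ennreal (1 - 1 / r)"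
    using assms by (simp add: inverse_ennreal ennreal_minus flip: ennreal_1 inverse_eq_divide)
  moreover have "1 - 1 / r > 0" "inverse (1 - 1 / r) = r / (r - 1)"
    using assms by (auto simp: field_simps)
  ultimately show ?thesis
    by (simp add: conj_exp_def inverse_ennreal)
qed

text \<open>Bounded partial sums of nonnegative terms give summability, which excludes the default
  value \<infinity> of \<open>lp_norm\<close>; the bound then passes to the limit.\<close>

lemma lp_norm_le_if_partial_sums_le:
  assumes "0 < q" and "0 \<le> c" and "\<And>n. (\<Sum>i<n. norm (a i) powr q) powr (1 / q) \<le> c"
  shows "lp_norm (ennreal q) a \<le> ennreal c"
proof -
  have le: "(\<Sum>i<n. norm (a i) powr q) \<le> c powr q" for n
  proof -
    have "(\<Sum>i<n. norm (a i) powr q) = ((\<Sum>i<n. norm (a i) powr q) powr (1 / q)) powr q"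
      using assms(1) by (simp add: powr_powr sum_nonneg)
    also have "\<dots> \<le> c powr q"
      using assms by (intro powr_mono2) auto
    finally show ?thesis .
  qed
  have s: "summable (\<lambda>i. norm (a i) powr q)"
    by (rule summableI_nonneg_bounded[OF _ le]) simp
  have "(\<Sum>i. norm (a i) powr q) powr (1 / q) \<le> (c powr q) powr (1 / q)"
    using assms(1) by (intro powr_mono2 suminf_le_const s le suminf_nonneg) auto
  also have "\<dots> = c"
    using assms by (simp add: powr_powr)
  finally show ?thesis
    using s assms(1) by (auto simp: lp_norm_def intro!: ennreal_leI)
qed

text \<open>Converse of Hoelder's inequality: in each of the cases \<open>p = 1\<close>,
  \<open>p = \<infinity>\<close> and \<open>1 < p < \<infinity>\<close> an extremal sequence, cut
  off to finite support, turns the pairing into the conjugate norm.\<close>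

lemma lp_norm_conj_exp_le:
  fixes a :: "nat \<Rightarrow> 'k::real_normed_field"
  assumes "1 \<le> p" and "0 \<le> c"
    and bound: "\<And>n \<beta>. lp_norm p \<beta> \<le> 1 \<Longrightarrow> (\<And>i. i \<ge> n \<Longrightarrow> \<beta> i = 0) \<Longrightarrow>
      norm (\<Sum>i<n. \<beta> i * a i) \<le> c"
  shows "lp_norm (conj_exp p) a \<le> ennreal c"
proof -
  \<comment> \<open>Phases that rotate each \<open>a i\<close> onto its norm; the value 1 at
    \<open>a i = 0\<close> keeps them of norm one everywhere.\<close>
  define u where "u i = (if a i = 0 then 1 else of_real (norm (a i)) / a i)" for i
  have u: "norm (u i) = 1" "u i * a i = of_real (norm (a i))" for i
    by (auto simp: u_def norm_divide)
  consider "p = 1" | "p = \<infinity>" | r where "p = ennreal r" "1 < r"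
    using assms(1) by (cases p) (auto simp: less_le)
  then show ?thesis
  proof cases
    case 1
    have "norm (a k) \<le> c" for k
    proof -
      \<comment> \<open>The \<open>k\<close>-th unit vector isolates one entry, which is all that
        the supremum norm asks for.\<close>
      let ?\<beta> = "\<lambda>i. if i = k then 1 else 0 :: 'k"
      have "norm (\<Sum>i<Suc k. ?\<beta> i * a i) \<le> c"
        by (intro bound lp_norm_single_term_le_1) (auto split: if_splits)
      then show ?thesis by (simp add: sum.neutral)
    qed
    then show ?thesis
      using 1 by (auto simp: lp_norm_def intro!: SUP_least ennreal_leI)
  next
    case 2
    have "(\<Sum>i<n. norm (a i)) \<le> c" for n
    proof -
      \<comment> \<open>For the supremum norm the truncated phases are extremal and produce the
        partial sums of the norms.\<close>
      let ?\<beta> = "\<lambda>i. if i < n then u i else 0"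
      have "norm (\<Sum>i<n. ?\<beta> i * a i) \<le> c"
        by (intro bound lp_norm_finite_support_le_1[where n = n]) (auto simp: 2 u)
      also have "(\<Sum>i<n. ?\<beta> i * a i) = of_real (\<Sum>i<n. norm (a i))"
        by (simp add: u)
      finally show ?thesis by (simp add: sum_nonneg flip: of_real_sum)
    qed
    then show ?thesis
      using lp_norm_le_if_partial_sums_le[of 1 c a] assms(2) 2 by (simp add: sum_nonneg)
  next
    case (3 r)
    define q where "q = r / (r - 1)"
    have q: "q > 1" "(q - 1) * r = q" "1 - 1 / r = 1 / q"
      using 3 by (auto simp: q_def field_simps)
    have "(\<Sum>i<n. norm (a i) powr q) powr (1 / q) \<le> c" for n
    proof -
      define A where "A = (\<Sum>i<n. norm (a i) powr q)"
      have "A \<ge> 0" by (simp add: A_def sum_nonneg)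
      show ?thesis
      proof (cases "A = 0")
        case True
        then show ?thesis using assms(2) by (simp flip: A_def)
      next
        case False
        then have "A > 0" using \<open>A \<ge> 0\<close> by simp
        \<comment> \<open>The equality case of Hoelder's inequality. Since
          \<open>(q - 1) * r = q\<close>, dividing by \<open>A powr (1 / r)\<close> normalises the
          \<open>r\<close>-th powers to sum 1, and the pairing becomes
          \<open>A / A powr (1 / r) = A powr (1 / q)\<close>.\<close>
        define b where "b i = norm (a i) powr (q - 1) / A powr (1 / r)" for i
        let ?\<beta> = "\<lambda>i. if i < n then of_real (b i) * u i else 0"
        have b: "b i \<ge> 0" for i by (simp add: b_def)
        have norm\<beta>: "norm (?\<beta> i) = (if i < n then b i else 0)" for i
          using b by (simp add: norm_mult u)
        have br: "b i powr r = norm (a i) powr q / A" for i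
          using 3 \<open>A > 0\<close> q by (simp add: b_def powr_divide powr_powr)
        have "(\<Sum>i<n. b i powr r) = 1"
          using \<open>A > 0\<close> by (simp add: br flip: sum_divide_distrib A_def)
        then have sum1: "(\<Sum>i<n. norm (?\<beta> i) powr r) = 1"
          unfolding norm\<beta> by simp
        have "lp_norm p ?\<beta> \<le> 1"
          using 3 sum1 by (subst lp_norm_finite_support[where n = n]) auto
        then have "norm (\<Sum>i<n. ?\<beta> i * a i) \<le> c"
          by (intro bound) auto
        moreover have "(\<Sum>i<n. ?\<beta> i * a i) = of_real (\<Sum>i<n. b i * norm (a i))"
          by (simp add: mult.assoc u)
        moreover have "(\<Sum>i<n. b i * norm (a i)) = A powr (1 / q)"
        proof -
          have "b i * norm (a i) = norm (a i) powr q / A powr (1 / r)" for i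
          proof (cases "a i = 0")
            case False
            then have "norm (a i) powr (q - 1) * norm (a i) = norm (a i) powr q"
              by (simp add: powr_diff)
            then show ?thesis by (simp add: b_def)
          qed (auto simp: b_def)
          then have "(\<Sum>i<n. b i * norm (a i)) = A / A powr (1 / r)"
            by (simp add: A_def sum_divide_distrib)
          also have "\<dots> = A powr (1 - 1 / r)"
            using \<open>A > 0\<close> by (simp add: powr_diff)
          finally show ?thesis using q by simp
        qed
        ultimately have "norm (of_real (A powr (1 / q)) :: 'k) \<le> c" by simp
        then show ?thesis by (simp add: A_def)
      qed
    qed
    then have "lp_norm (ennreal q) a \<le> ennreal c"
      using q assms(2) by (intro lp_norm_le_if_partial_sums_le) auto
    then show ?thesis using 3 by (simp add: conj_exp_ennreal q_def)
  qed
qed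

subsection \<open>Regular Borel measures\<close>

text \<open>Countable additivity for the constant empty family gives a convergent series with
  constant terms, so these terms vanish.\<close>

lemma regular_borel_measure_empty:
  assumes "regular_borel_measure \<mu>"
  shows "\<mu> {} = 0"
proof -
  have "(\<lambda>n::nat. \<mu> {}) sums \<mu> (\<Union>n::nat. {})"
    using assms unfolding regular_borel_measure_def
    by (auto dest!: spec[of _ "\<lambda>n. {}"] simp: disjoint_family_on_def)
  then show ?thesis
    by (auto dest!: sums_summable summable_LIMSEQ_zero simp: LIMSEQ_const_iff)
qed

text \<open>The definition provides only countable additivity along the natural numbers; a finite
  family is enumerated and padded with empty sets.\<close>

lemma regular_borel_measure_Union:
  assumes "regular_borel_measure \<mu>" and "finite J"
    and "\<And>j. j \<in> J \<Longrightarrow> D j \<in> sets borel" and "disjoint_family_on D J"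
  shows "\<mu> (\<Union>j\<in>J. D j) = (\<Sum>j\<in>J. \<mu> (D j))"
proof -
  obtain e :: "nat \<Rightarrow> _" where e: "bij_betw e {..<card J} J"
    using assms(2) ex_bij_betw_nat_finite by (metis atLeast0LessThan)
  define A where "A n = (if n < card J then D (e n) else {})" for n
  have mem: "e n \<in> J" if "n < card J" for n
    using e that by (auto simp: bij_betw_def)
  have "range A \<subseteq> sets borel"
    using assms(3) mem by (auto simp: A_def)
  moreover have "disjoint_family A"
    unfolding disjoint_family_on_def
  proof (intro ballI impI)
    fix m n :: nat assume "m \<noteq> n"
    then have "e m \<noteq> e n" if "m < card J" "n < card J"
      using e that by (auto simp: bij_betw_def inj_on_def)
    then show "A m \<inter> A n = {}"
      using assms(4) mem by (auto simp: A_def disjoint_family_on_def)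
  qed
  ultimately have "(\<lambda>n. \<mu> (A n)) sums \<mu> (\<Union>n. A n)"
    using assms(1) unfolding regular_borel_measure_def by blast
  moreover have "(\<lambda>n. \<mu> (A n)) sums (\<Sum>n<card J. \<mu> (A n))"
    by (rule sums_finite) (auto simp: A_def regular_borel_measure_empty[OF assms(1)])
  ultimately have "\<mu> (\<Union>n. A n) = (\<Sum>n<card J. \<mu> (A n))"
    by (rule sums_unique2)
  moreover have "(\<Union>n. A n) = (\<Union>j\<in>J. D j)"
  proof -
    have "(\<Union>n. A n) = \<Union> (D ` e ` {..<card J})" by (auto simp: A_def split: if_splits)
    then show ?thesis by (simp only: bij_betw_imp_surj_on[OF e])
  qed
  moreover have "(\<Sum>n<card J. \<mu> (A n)) = (\<Sum>j\<in>J. \<mu> (D j))"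
    using sum.reindex_bij_betw[OF e, of "\<lambda>j. \<mu> (D j)"] by (simp add: A_def)
  ultimately show ?thesis by simp
qed

lemma total_variation_mono:
  assumes "A \<in> sets borel" "B \<in> sets borel" "A \<subseteq> B"
  shows "total_variation \<mu> A \<le> total_variation \<mu> B"
  unfolding total_variation_def
proof (rule SUP_mono)
  fix P assume P: "P \<in> {P. finite P \<and> disjoint P \<and> P \<subseteq> sets borel \<and> \<Union> P = A}"
  show "\<exists>Q\<in>{P. finite P \<and> disjoint P \<and> P \<subseteq> sets borel \<and> \<Union> P = B}.
      (\<Sum>A\<in>P. ennreal (norm (\<mu> A))) \<le> (\<Sum>A\<in>Q. ennreal (norm (\<mu> A)))"
  \<comment> \<open>One additional block completes a partition of \<open>A\<close> to a partition of
    \<open>B\<close>.\<close>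
  proof (rule bexI[of _ "insert (B - A) P"])
    show "(\<Sum>A\<in>P. ennreal (norm (\<mu> A))) \<le> (\<Sum>A\<in>insert (B - A) P. ennreal (norm (\<mu> A)))"
      using P by (intro sum_mono2) auto
    have "B - A \<in> sets borel" using assms by auto
    moreover have "disjoint (insert (B - A) P)"
      using P by (auto simp: disjoint_def)
    ultimately show "insert (B - A) P \<in> {P. finite P \<and> disjoint P \<and> P \<subseteq> sets borel \<and> \<Union> P = B}"
      using P assms by auto
  qed
qed

lemma sum_le_total_variation:
  assumes "regular_borel_measure \<mu>" and "finite J"
    and "\<And>j. j \<in> J \<Longrightarrow> D j \<in> sets borel" and "disjoint_family_on D J"
    and "\<And>j. j \<in> J \<Longrightarrow> D j \<subseteq> A" and "A \<in> sets borel"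
  shows "(\<Sum>j\<in>J. norm (\<mu> (D j))) \<le> enn2real (total_variation \<mu> A)"
proof -
  \<comment> \<open>The total variation ranges over sets of blocks, not indexed families. Disjoint
    nonempty blocks are distinct, so the indexing becomes injective once the empty blocks, of
    measure zero, are dropped.\<close>
  let ?J = "{j \<in> J. D j \<noteq> {}}" and ?U = "\<Union>j\<in>J. D j"
  have inj: "inj_on D ?J"
    using assms(4) by (auto simp: inj_on_def disjoint_family_on_def)
  have U: "?U \<in> sets borel" using assms(2,3) by auto
  have "ennreal (\<Sum>j\<in>J. norm (\<mu> (D j))) = (\<Sum>j\<in>J. ennreal (norm (\<mu> (D j))))"
    by simp
  also have "\<dots> = (\<Sum>j\<in>?J. ennreal (norm (\<mu> (D j))))"
    using assms(2) regular_borel_measure_empty[OF assms(1)]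
    by (intro sum.mono_neutral_right) auto
  also have "\<dots> = (\<Sum>B\<in>D ` ?J. ennreal (norm (\<mu> B)))"
    by (simp add: sum.reindex[OF inj])
  also have "\<dots> \<le> total_variation \<mu> ?U"
    unfolding total_variation_def
    using assms(2,3,4)
    by (intro SUP_upper) (auto intro!: pairwise_imageI simp: disjoint_family_on_def disjnt_def)
  also have "\<dots> \<le> total_variation \<mu> A"
    by (rule total_variation_mono) (use assms U in auto)
  finally have le: "ennreal (\<Sum>j\<in>J. norm (\<mu> (D j))) \<le> total_variation \<mu> A" .
  \<comment> \<open>Finiteness must come before \<open>enn2real\<close>, which sends \<infinity> to
    0.\<close>
  have "total_variation \<mu> A \<le> total_variation \<mu> UNIV"
    by (rule total_variation_mono) (use assms in auto)
  also have "\<dots> < \<infinity>" using assms(1) by (simp add: regular_borel_measure_def)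
  finally show ?thesis
    using enn2real_mono[OF le] by (simp add: sum_nonneg)
qed

section \<open>Integrals and their stability under small changes of the integrand\<close>

text \<open>\<open>simple_int\<close> groups points by the values of one function; comparing two
  integrals term by term requires the common refinement of both families of level sets.\<close>

lemma simple_int_refine:
  assumes "regular_borel_measure \<mu>" and "simple_function borel g" and "simple_function borel h"
  shows "simple_int \<mu> g = (\<Sum>(v, w)\<in>range g \<times> range h. v * \<mu> (g -` {v} \<inter> h -` {w}))"
proof -
  have "\<mu> (g -` {v}) = (\<Sum>w\<in>range h. \<mu> (g -` {v} \<inter> h -` {w}))" if "v \<in> range g" for v
  proof -
    have "g -` {v} = (\<Union>w\<in>range h. g -` {v} \<inter> h -` {w})" by auto
    also have "\<mu> \<dots> = (\<Sum>w\<in>range h. \<mu> (g -` {v} \<inter> h -` {w}))"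
      using assms that
      by (intro regular_borel_measure_Union) (auto simp: simple_function_def disjoint_family_on_def)
    finally show ?thesis .
  qed
  then show ?thesis
    by (simp add: simple_int_def sum_distrib_left sum.cartesian_product)
qed

text \<open>Each cell of the common refinement is cut along \<open>A\<close>. A nonempty piece
  contains a point at which the bound \<open>s\<close> or \<open>t\<close> controls the difference
  of the two values; an empty piece has measure zero. Summing gives the two total
  variations.\<close>

lemma simple_int_diff_le:
  assumes \<mu>: "regular_borel_measure \<mu>" and g: "simple_function borel g" and h: "simple_function borel h"
    and A: "A \<in> sets borel" and "0 \<le> s" "0 \<le> t"
    and s: "\<And>\<omega>. \<omega> \<in> A \<Longrightarrow> norm (g \<omega> - h \<omega>) \<le> s"
    and t: "\<And>\<omega>. \<omega> \<notin> A \<Longrightarrow> norm (g \<omega> - h \<omega>) \<le> t"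
  shows "norm (simple_int \<mu> g - simple_int \<mu> h) \<le>
    s * enn2real (total_variation \<mu> A) + t * enn2real (total_variation \<mu> UNIV)"
proof -
  let ?J = "range g \<times> range h"
  define D where "D = (\<lambda>(v, w). g -` {v} \<inter> h -` {w})"
  have fin: "finite ?J" using g h by (auto simp: simple_function_def)
  have D: "D j \<in> sets borel" if "j \<in> ?J" for j
    using g h that by (auto simp: simple_function_def D_def)
  have DA: "D j \<inter> A \<in> sets borel" "D j - A \<in> sets borel" if "j \<in> ?J" for j
    using D[OF that] A by auto
  have disj: "disjoint_family_on (\<lambda>j. D j \<inter> A) ?J" "disjoint_family_on (\<lambda>j. D j - A) ?J"
    by (auto simp: disjoint_family_on_def D_def)
  have split: "\<mu> (D j) = \<mu> (D j \<inter> A) + \<mu> (D j - A)" if "j \<in> ?J" for j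
  proof -
    \<comment> \<open>A union over the two truth values presents the halves of a cell as a finite
      family.\<close>
    have "\<mu> (\<Union>b\<in>UNIV. if b then D j \<inter> A else D j - A) =
        (\<Sum>b\<in>UNIV. \<mu> (if b then D j \<inter> A else D j - A))"
      using DA[OF that] by (intro regular_borel_measure_Union[OF \<mu>]) (auto simp: disjoint_family_on_def)
    moreover have "(\<Union>b\<in>UNIV. if b then D j \<inter> A else D j - A) = D j"
      by (auto split: if_splits)
    ultimately show ?thesis by (simp add: UNIV_bool)
  qed
  \<comment> \<open>Refining \<open>h\<close> by \<open>g\<close> yields the same cells with the
    index pairs swapped.\<close>
  have "simple_int \<mu> h = (\<Sum>(w, v)\<in>range h \<times> range g. w * \<mu> (D (v, w)))"
    by (simp add: simple_int_refine[OF \<mu> h g] D_def Int_commute)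
  also have "\<dots> = (\<Sum>(v, w)\<in>?J. w * \<mu> (D (v, w)))"
    by (simp add: sum.cartesian_product[symmetric] sum.swap[of _ "range h"])
  finally have "simple_int \<mu> g - simple_int \<mu> h = (\<Sum>(v, w)\<in>?J. (v - w) * \<mu> (D (v, w)))"
    by (simp add: simple_int_refine[OF \<mu> g h] D_def sum_subtractf case_prod_unfold left_diff_distrib)
  also have "norm \<dots> \<le> (\<Sum>j\<in>?J. norm (fst j - snd j) * norm (\<mu> (D j)))"
    by (rule norm_sum[THEN order_trans]) (simp add: case_prod_unfold norm_mult)
  also have "\<dots> \<le> (\<Sum>j\<in>?J. s * norm (\<mu> (D j \<inter> A)) + t * norm (\<mu> (D j - A)))"
  proof (rule sum_mono)
    fix j assume j: "j \<in> ?J"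
    have "norm (fst j - snd j) * norm (\<mu> (D j)) \<le>
        norm (fst j - snd j) * norm (\<mu> (D j \<inter> A)) + norm (fst j - snd j) * norm (\<mu> (D j - A))"
      unfolding split[OF j] distrib_left[symmetric]
      by (intro mult_left_mono norm_triangle_ineq) auto
    also have "norm (fst j - snd j) * norm (\<mu> (D j \<inter> A)) \<le> s * norm (\<mu> (D j \<inter> A))"
    proof (cases "D j \<inter> A = {}")
      case False
      then obtain \<omega> where "\<omega> \<in> A" "g \<omega> = fst j" "h \<omega> = snd j"
        by (auto simp: D_def case_prod_unfold)
      then show ?thesis using s[of \<omega>] by (intro mult_right_mono) auto
    qed (simp add: regular_borel_measure_empty[OF \<mu>])
    also have "norm (fst j - snd j) * norm (\<mu> (D j - A)) \<le> t * norm (\<mu> (D j - A))"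
    proof (cases "D j - A = {}")
      case True
      show ?thesis unfolding True by (simp add: regular_borel_measure_empty[OF \<mu>])
    next
      case False
      then obtain \<omega> where "\<omega> \<notin> A" "g \<omega> = fst j" "h \<omega> = snd j"
        by (auto simp: D_def case_prod_unfold)
      then show ?thesis using t[of \<omega>] by (intro mult_right_mono) auto
    qed
    finally show "norm (fst j - snd j) * norm (\<mu> (D j)) \<le>
        s * norm (\<mu> (D j \<inter> A)) + t * norm (\<mu> (D j - A))"
      by simp
  qed
  also have "\<dots> = s * (\<Sum>j\<in>?J. norm (\<mu> (D j \<inter> A))) + t * (\<Sum>j\<in>?J. norm (\<mu> (D j - A)))"
    by (simp add: sum.distrib sum_distrib_left)
  also have "\<dots> \<le> s * enn2real (total_variation \<mu> A) + t * enn2real (total_variation \<mu> UNIV)"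
    using disj fin DA A assms(5,6)
    by (intro add_mono mult_left_mono sum_le_total_variation[OF \<mu>]) auto
  finally show ?thesis .
qed

text \<open>Simple functions within \<epsilon>/2 of \<open>g\<close> and of \<open>h\<close> differ
  by at most \<open>1 + \<epsilon>\<close> on \<open>A\<close> and by at most \<epsilon> elsewhere.
  Passing to the limit along the approximations, and then letting \<epsilon> decrease to 0, leaves
  only the variation on \<open>A\<close>.\<close>

lemma has_measure_integral_diff_le:
  assumes \<mu>: "regular_borel_measure \<mu>"
    and I: "has_measure_integral \<mu> g I" and J: "has_measure_integral \<mu> h J"
    and A: "A \<in> sets borel"
    and s: "\<And>\<omega>. norm (g \<omega> - h \<omega>) \<le> 1" and t: "\<And>\<omega>. \<omega> \<notin> A \<Longrightarrow> g \<omega> = h \<omega>"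
  shows "norm (I - J) \<le> enn2real (total_variation \<mu> A)"
proof -
  let ?a = "enn2real (total_variation \<mu> A)" and ?b = "enn2real (total_variation \<mu> UNIV)"
  obtain g' where g': "\<And>n. simple_function borel (g' n)" "uniform_limit UNIV g' g sequentially"
    "(\<lambda>n. simple_int \<mu> (g' n)) \<longlonglongrightarrow> I"
    using I unfolding has_measure_integral_def by blast
  obtain h' where h': "\<And>n. simple_function borel (h' n)" "uniform_limit UNIV h' h sequentially"
    "(\<lambda>n. simple_int \<mu> (h' n)) \<longlonglongrightarrow> J"
    using J unfolding has_measure_integral_def by blast
  have bound: "norm (I - J) \<le> (1 + \<epsilon>) * ?a + \<epsilon> * ?b" if "\<epsilon> > 0" for \<epsilon>
  proof (rule tendsto_upperbound)
    show "(\<lambda>n. norm (simple_int \<mu> (g' n) - simple_int \<mu> (h' n))) \<longlonglongrightarrow> norm (I - J)"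
      by (intro tendsto_intros g' h')
    have "\<forall>\<^sub>F n in sequentially. \<forall>\<omega>\<in>UNIV. dist (g' n \<omega>) (g \<omega>) < \<epsilon> / 2"
      "\<forall>\<^sub>F n in sequentially. \<forall>\<omega>\<in>UNIV. dist (h' n \<omega>) (h \<omega>) < \<epsilon> / 2"
      using that g'(2) h'(2) by (auto dest!: uniform_limitD[where e = "\<epsilon> / 2"])
    then show "\<forall>\<^sub>F n in sequentially. norm (simple_int \<mu> (g' n) - simple_int \<mu> (h' n)) \<le>
        (1 + \<epsilon>) * ?a + \<epsilon> * ?b"
    proof eventually_elim
      case (elim n)
      have close: "norm (g' n \<omega> - h' n \<omega>) \<le> norm (g \<omega> - h \<omega>) + \<epsilon>" for \<omega>
      proof -
        have "norm (g' n \<omega> - g \<omega>) < \<epsilon> / 2" "norm (h' n \<omega> - h \<omega>) < \<epsilon> / 2"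
          using elim by (auto simp: dist_norm)
        moreover have eq: "g' n \<omega> - h' n \<omega> = (g' n \<omega> - g \<omega>) - (h' n \<omega> - h \<omega>) + (g \<omega> - h \<omega>)"
          by simp
        ultimately show ?thesis
          using norm_triangle_ineq[of "(g' n \<omega> - g \<omega>) - (h' n \<omega> - h \<omega>)" "g \<omega> - h \<omega>"]
            norm_triangle_ineq4[of "g' n \<omega> - g \<omega>" "h' n \<omega> - h \<omega>"]
          by (simp only:)
      qed
      show ?case
      proof (rule simple_int_diff_le[OF \<mu> g'(1) h'(1) A])
        show "norm (g' n \<omega> - h' n \<omega>) \<le> 1 + \<epsilon>" for \<omega>
          using close[of \<omega>] s[of \<omega>] by linarith
        show "norm (g' n \<omega> - h' n \<omega>) \<le> \<epsilon>" if "\<omega> \<notin> A" for \<omega>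
          using close[of \<omega>] t[OF that] by simp
      qed (use that in auto)
    qed
  qed simp
  show ?thesis
  proof (rule tendsto_lowerbound)
    show "((\<lambda>\<epsilon>. (1 + \<epsilon>) * ?a + \<epsilon> * ?b) \<longlongrightarrow> ?a) (at_right 0)"
      by (rule tendsto_eq_intros refl | simp)+
    show "\<forall>\<^sub>F \<epsilon> in at_right 0. norm (I - J) \<le> (1 + \<epsilon>) * ?a + \<epsilon> * ?b"
      using bound by (auto simp: eventually_at_right_field intro: exI[of _ 1])
  qed simp
qed

subsection \<open>Dual spaces and adjoint operators\<close>

lemma op_space_apply: "T \<in> vset (op_space V W) \<Longrightarrow> v \<in> vset V \<Longrightarrow> T v \<in> vset W"
  and op_space_add: "T \<in> vset (op_space V W) \<Longrightarrow> u \<in> vset V \<Longrightarrow> v \<in> vset V \<Longrightarrow>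
    T (vadd V u v) = vadd W (T u) (T v)"
  and op_space_scale: "T \<in> vset (op_space V W) \<Longrightarrow> v \<in> vset V \<Longrightarrow>
    T (vscale V c v) = vscale W c (T v)"
  by (auto simp: op_space_def)

lemma vadd_op_space: "vadd (op_space V W) T R = (\<lambda>v\<in>vset V. vadd W (T v) (R v))"
  and vscale_op_space: "vscale (op_space V W) c T = (\<lambda>v\<in>vset V. vscale W c (T v))"
  by (simp_all add: op_space_def)

lemma op_space_bounded:
  "T \<in> vset (op_space V W) \<Longrightarrow> \<exists>B. \<forall>v\<in>vset V. vnorm W (T v) \<le> B * vnorm V v"
  by (simp add: op_space_def)

text \<open>The record \<open>nspace\<close> carries no axioms. These properties of normed spaces
  are inherited by duals, so every statement proved here is also available on iterated
  duals.\<close>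

locale homogeneous_nspace =
  fixes V :: "('k::rc_field, 'v) nspace"
  assumes vset_nonempty: "vset V \<noteq> {}"
    and vadd_closed: "u \<in> vset V \<Longrightarrow> v \<in> vset V \<Longrightarrow> vadd V u v \<in> vset V"
    and vscale_closed: "v \<in> vset V \<Longrightarrow> vscale V c v \<in> vset V"
    and vnorm_nonneg: "v \<in> vset V \<Longrightarrow> 0 \<le> vnorm V v"
    and vnorm_vscale_le: "v \<in> vset V \<Longrightarrow> vnorm V (vscale V c v) \<le> norm c * vnorm V v"
begin

text \<open>Scaling any vector by 0 gives norm at most 0. The operator norm is a real supremum,
  meaningful only over a nonempty bounded set.\<close>

lemma unit_ball_nonempty: "unit_ball V \<noteq> {}"
proof -
  obtain v where v: "v \<in> vset V" using vset_nonempty by blast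
  then have "vscale V 0 v \<in> unit_ball V"
    using vscale_closed[OF v, of 0] vnorm_vscale_le[OF v, of 0] by (simp add: unit_ball_def)
  then show ?thesis by blast
qed

lemma op_norm_upper:
  assumes "T \<in> vset (op_space V W)" and "v \<in> unit_ball V"
  shows "vnorm W (T v) \<le> vnorm (op_space V W) T"
proof -
  obtain B where B: "\<And>v. v \<in> vset V \<Longrightarrow> vnorm W (T v) \<le> B * vnorm V v"
    using op_space_bounded[OF assms(1)] by blast
  \<comment> \<open>The constant \<open>B\<close> has no prescribed sign, hence the absolute
    value.\<close>
  have "vnorm W (T v) \<le> \<bar>B\<bar>" if "v \<in> unit_ball V" for v
  proof -
    have v: "v \<in> vset V" "0 \<le> vnorm V v" "vnorm V v \<le> 1"
      using that vnorm_nonneg by (auto simp: unit_ball_def)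
    have "B * vnorm V v \<le> \<bar>B\<bar> * 1" using v by (intro mult_mono) auto
    then show ?thesis using B[OF v(1)] by simp
  qed
  then have "bdd_above ((\<lambda>v. vnorm W (T v)) ` unit_ball V)"
    by (intro bdd_aboveI2)
  then show ?thesis
    using assms(2) by (auto simp: op_space_def intro: cSUP_upper)
qed

lemma op_norm_least:
  assumes "\<And>v. v \<in> unit_ball V \<Longrightarrow> vnorm W (T v) \<le> b"
  shows "vnorm (op_space V W) T \<le> b"
  using assms unit_ball_nonempty by (auto simp: op_space_def intro!: cSUP_least)

lemma op_norm_bound:
  assumes T: "T \<in> vset (op_space V (type_space s))" and v: "v \<in> vset V"
    and s: "\<And>c w. norm (s c w) = norm c * norm w"
  shows "norm (T v) \<le> vnorm (op_space V (type_space s)) T * vnorm V v"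
proof (cases "vnorm V v = 0")
  case True
  \<comment> \<open>A vector of norm 0 cannot be normalised; boundedness already forces its image to
    be 0.\<close>
  obtain B where "\<And>v. v \<in> vset V \<Longrightarrow> norm (T v) \<le> B * vnorm V v"
    using op_space_bounded[OF T] by (auto simp: type_space_def)
  from this[OF v] show ?thesis using True by simp
next
  case False
  define t where "t = vnorm V v"
  have t: "t > 0" using False vnorm_nonneg[OF v] by (simp add: t_def)
  let ?c = "of_real (1 / t) :: 'k"
  have "vscale V ?c v \<in> unit_ball V"
    using vscale_closed[OF v, of ?c] vnorm_vscale_le[OF v, of ?c] t
    by (simp add: unit_ball_def norm_divide flip: t_def)
  from op_norm_upper[OF T this]
  have "norm (T (vscale V ?c v)) \<le> vnorm (op_space V (type_space s)) T"
    by (simp add: type_space_def)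
  moreover have "T (vscale V ?c v) = s ?c (T v)"
    using T v by (auto simp: op_space_def type_space_def)
  ultimately show ?thesis
    using t by (simp add: s norm_divide field_simps flip: t_def)
qed

end

lemma vset_dual_iff:
  "f \<in> vset (dual V) \<longleftrightarrow> f \<in> extensional (vset V) \<and>
     (\<forall>u\<in>vset V. \<forall>v\<in>vset V. f (vadd V u v) = f u + f v) \<and>
     (\<forall>c. \<forall>v\<in>vset V. f (vscale V c v) = c * f v) \<and>
     (\<exists>B. \<forall>v\<in>vset V. norm (f v) \<le> B * vnorm V v)"
  by (auto simp: dual_def op_space_def type_space_def PiE_def)

lemma vadd_dual: "vadd (dual V) f g = (\<lambda>v\<in>vset V. f v + g v)"
  and vscale_dual: "vscale (dual V) c f = (\<lambda>v\<in>vset V. c * f v)"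
  by (simp_all add: dual_def vadd_op_space vscale_op_space type_space_def)

context homogeneous_nspace
begin

lemma dual_bound:
  assumes "f \<in> vset (dual V)" and "v \<in> vset V"
  shows "norm (f v) \<le> vnorm (dual V) f * vnorm V v"
  using op_norm_bound[of f "(*)" v] assms by (simp add: dual_def norm_mult)

lemma vnorm_dual_le:
  assumes "\<And>v. v \<in> unit_ball V \<Longrightarrow> norm (f v) \<le> b"
  shows "vnorm (dual V) f \<le> b"
  using op_norm_least[of "type_space (*)" f b] assms by (simp add: dual_def type_space_def)

lemma zero_in_dual: "(\<lambda>v\<in>vset V. 0) \<in> vset (dual V)"
  by (auto simp: vset_dual_iff vadd_closed vscale_closed intro: exI[of _ 0])

lemma homogeneous_nspace_dual: "homogeneous_nspace (dual V)"
proof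
  show "vset (dual V) \<noteq> {}" using zero_in_dual by blast
next
  fix f g assume f: "f \<in> vset (dual V)" and g: "g \<in> vset (dual V)"
  obtain B C where "\<And>v. v \<in> vset V \<Longrightarrow> norm (f v) \<le> B * vnorm V v"
    "\<And>v. v \<in> vset V \<Longrightarrow> norm (g v) \<le> C * vnorm V v"
    using f g by (metis vset_dual_iff)
  then have "norm (f v + g v) \<le> (B + C) * vnorm V v" if "v \<in> vset V" for v
    using that by (intro norm_triangle_le) (auto simp: distrib_right intro: add_mono)
  then have "\<exists>B. \<forall>v\<in>vset V. norm (f v + g v) \<le> B * vnorm V v" by blast
  then show "vadd (dual V) f g \<in> vset (dual V)"
    using f g by (auto simp: vset_dual_iff vadd_dual vadd_closed vscale_closed algebra_simps)
next
  fix f and c :: 'k assume f: "f \<in> vset (dual V)"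
  obtain B where "\<And>v. v \<in> vset V \<Longrightarrow> norm (f v) \<le> B * vnorm V v"
    using f by (metis vset_dual_iff)
  then have "norm (c * f v) \<le> (norm c * B) * vnorm V v" if "v \<in> vset V" for v
    using that by (simp add: norm_mult mult.assoc mult_left_mono)
  then have "\<exists>B. \<forall>v\<in>vset V. norm (c * f v) \<le> B * vnorm V v" by blast
  then show "vscale (dual V) c f \<in> vset (dual V)"
    using f by (auto simp: vset_dual_iff vscale_dual vadd_closed vscale_closed algebra_simps)
next
  fix f assume f: "f \<in> vset (dual V)"
  obtain v where v: "v \<in> unit_ball V" using unit_ball_nonempty by blast
  have "0 \<le> norm (f v)" by simp
  also have "\<dots> \<le> vnorm (dual V) f"
    using op_norm_upper[of f "type_space (*)" v] f v by (simp add: dual_def type_space_def)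
  finally show "0 \<le> vnorm (dual V) f" .
next
  fix f and c :: 'k assume f: "f \<in> vset (dual V)"
  show "vnorm (dual V) (vscale (dual V) c f) \<le> norm c * vnorm (dual V) f"
  proof (rule vnorm_dual_le)
    fix v assume v: "v \<in> unit_ball V"
    have "norm (f v) \<le> vnorm (dual V) f"
      using op_norm_upper[of f "type_space (*)" v] f v by (simp add: dual_def type_space_def)
    then show "norm (vscale (dual V) c f v) \<le> norm c * vnorm (dual V) f"
      using v by (simp add: vscale_dual unit_ball_def norm_mult mult_left_mono)
  qed
qed

lemma dual_unit_ball_bound:
  assumes "f \<in> unit_ball (dual V)" and "v \<in> vset V"
  shows "norm (f v) \<le> vnorm V v"
proof -
  have "norm (f v) \<le> vnorm (dual V) f * vnorm V v"
    using assms by (intro dual_bound) (auto simp: unit_ball_def)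
  also have "\<dots> \<le> 1 * vnorm V v"
    using assms vnorm_nonneg by (intro mult_right_mono) (auto simp: unit_ball_def)
  finally show ?thesis by simp
qed

text \<open>Elements of the dual are functions restricted to the carrier, with their own addition
  and scaling. Induction identifies the pointwise combination with an iterated sum in the dual, to
  which the linearity of \<open>f\<close> applies.\<close>

lemma dual_linear_combination:
  fixes n :: nat
  assumes \<xi>: "\<And>i. \<xi> i \<in> vset (dual V)" and f: "f \<in> vset (dual (dual V))"
  shows "(\<lambda>v\<in>vset V. \<Sum>i<n. \<beta> i * \<xi> i v) \<in> vset (dual V) \<and>
    f (\<lambda>v\<in>vset V. \<Sum>i<n. \<beta> i * \<xi> i v) = (\<Sum>i<n. \<beta> i * f (\<xi> i))"
proof (induction n)
  case 0
  \<comment> \<open>The zero functional is 0 times itself, so homogeneity makes \<open>f\<close>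
    vanish there.\<close>
  have "f (vscale (dual V) 0 (\<lambda>v\<in>vset V. 0)) = 0"
    using f zero_in_dual by (simp add: vset_dual_iff[of f])
  moreover have "vscale (dual V) 0 (\<lambda>v\<in>vset V. 0) = (\<lambda>v\<in>vset V. 0)"
    by (auto simp: vscale_dual)
  ultimately show ?case
    using zero_in_dual by (simp only: lessThan_0 sum.empty simp_thms)
next
  case (Suc n)
  interpret dual: homogeneous_nspace "dual V" by (rule homogeneous_nspace_dual)
  let ?g = "\<lambda>n. \<lambda>v\<in>vset V. \<Sum>i<n. \<beta> i * \<xi> i v"
  have eq: "?g (Suc n) = vadd (dual V) (?g n) (vscale (dual V) (\<beta> n) (\<xi> n))"
    by (auto simp: vadd_dual vscale_dual)
  have \<beta>\<xi>: "vscale (dual V) (\<beta> n) (\<xi> n) \<in> vset (dual V)"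
    using \<xi> by (rule dual.vscale_closed)
  have f_add: "f (vadd (dual V) g h) = f g + f h"
    if "g \<in> vset (dual V)" "h \<in> vset (dual V)" for g h
    using f that by (simp add: vset_dual_iff[of f])
  have f_scale: "f (vscale (dual V) (\<beta> n) (\<xi> n)) = \<beta> n * f (\<xi> n)"
    using f \<xi> by (simp add: vset_dual_iff[of f])
  have g: "?g n \<in> vset (dual V)" "f (?g n) = (\<Sum>i<n. \<beta> i * f (\<xi> i))"
    using Suc by (rule conjunct1, rule conjunct2)
  show ?case
    unfolding eq f_add[OF g(1) \<beta>\<xi>] g(2) f_scale
    using dual.vadd_closed[OF g(1) \<beta>\<xi>] by (simp only: sum.lessThan_Suc simp_thms)
qed

end

section \<open>Adjoints and biadjoints\<close>

lemma adjoint_op_in_dual: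
  assumes V: "homogeneous_nspace V" and W: "homogeneous_nspace W"
    and T: "T \<in> vset (op_space V W)" and f: "f \<in> vset (dual W)"
  shows "adjoint_op V W T f \<in> vset (dual V)"
proof -
  interpret V: homogeneous_nspace V by fact
  interpret W: homogeneous_nspace W by fact
  obtain C where C: "\<And>v. v \<in> vset V \<Longrightarrow> vnorm W (T v) \<le> C * vnorm V v"
    using op_space_bounded[OF T] by blast
  have TW: "T v \<in> vset W" if "v \<in> vset V" for v
    using T that by (auto simp: op_space_def)
  interpret dW: homogeneous_nspace "dual W" by (rule W.homogeneous_nspace_dual)
  have "norm (f (T v)) \<le> (vnorm (dual W) f * C) * vnorm V v" if "v \<in> vset V" for v
  proof -
    have "norm (f (T v)) \<le> vnorm (dual W) f * vnorm W (T v)"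
      using f TW[OF that] by (rule W.dual_bound)
    also have "\<dots> \<le> vnorm (dual W) f * (C * vnorm V v)"
      using C[OF that] dW.vnorm_nonneg[OF f] by (rule mult_left_mono)
    finally show ?thesis by (simp add: mult.assoc)
  qed
  moreover have "T (vadd V u v) = vadd W (T u) (T v)" "T (vscale V c v) = vscale W c (T v)"
    if "u \<in> vset V" "v \<in> vset V" for u v c
    using T that by (auto simp: op_space_def)
  ultimately show ?thesis
    using f TW
    by (auto simp: vset_dual_iff adjoint_op_def V.vadd_closed V.vscale_closed)
qed

lemma adjoint_op_in_op_space:
  assumes V: "homogeneous_nspace V" and W: "homogeneous_nspace W"
    and T: "T \<in> vset (op_space V W)"
  shows "adjoint_op V W T \<in> vset (op_space (dual W) (dual V))"
proof -
  interpret V: homogeneous_nspace V by fact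
  interpret W: homogeneous_nspace W by fact
  interpret dW: homogeneous_nspace "dual W" by (rule W.homogeneous_nspace_dual)
  obtain C where C: "\<And>v. v \<in> vset V \<Longrightarrow> vnorm W (T v) \<le> C * vnorm V v"
    using op_space_bounded[OF T] by blast
  have TW: "T v \<in> vset W" if "v \<in> vset V" for v
    using T that by (auto simp: op_space_def)
  have "vnorm (dual V) (adjoint_op V W T f) \<le> \<bar>C\<bar> * vnorm (dual W) f"
    if f: "f \<in> vset (dual W)" for f
  proof (rule V.vnorm_dual_le)
    fix v assume "v \<in> unit_ball V"
    then have v: "v \<in> vset V" "vnorm V v \<le> 1" by (auto simp: unit_ball_def)
    have "C * vnorm V v \<le> \<bar>C\<bar> * 1"
      using v V.vnorm_nonneg by (intro mult_mono) auto
    then have "vnorm W (T v) \<le> \<bar>C\<bar>" using C[OF v(1)] by simp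
    then have "vnorm (dual W) f * vnorm W (T v) \<le> vnorm (dual W) f * \<bar>C\<bar>"
      using dW.vnorm_nonneg[OF f] by (rule mult_left_mono)
    then show "norm (adjoint_op V W T f v) \<le> \<bar>C\<bar> * vnorm (dual W) f"
      using W.dual_bound[OF f TW[OF v(1)]] f v by (simp add: adjoint_op_def mult.commute)
  qed
  moreover have "adjoint_op V W T \<in> vset (dual W) \<rightarrow>\<^sub>E vset (dual V)"
    using adjoint_op_in_dual[OF V W T] by (auto simp: adjoint_op_def)
  moreover have "adjoint_op V W T (vadd (dual W) f g) =
      vadd (dual V) (adjoint_op V W T f) (adjoint_op V W T g)"
    if "f \<in> vset (dual W)" "g \<in> vset (dual W)" for f g
    using dW.vadd_closed[OF that] that TW by (auto simp: adjoint_op_def vadd_dual)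
  moreover have "adjoint_op V W T (vscale (dual W) c f) =
      vscale (dual V) c (adjoint_op V W T f)"
    if "f \<in> vset (dual W)" for f c
    using dW.vscale_closed[OF that, of c] that TW by (auto simp: adjoint_op_def vscale_dual)
  ultimately show ?thesis
    by (auto simp: op_space_def)
qed

text \<open>The adjoint is itself a bounded operator between duals, so its own adjoint sends
  functionals to functionals.\<close>

lemma biadjoint_op_in_bidual:
  assumes "homogeneous_nspace V" and "homogeneous_nspace W"
    and "T \<in> vset (op_space V W)" and "\<xi> \<in> vset (dual (dual V))"
  shows "biadjoint_op V W T \<xi> \<in> vset (dual (dual W))"
  unfolding biadjoint_op_def
  using assms
  by (intro adjoint_op_in_dual adjoint_op_in_op_space homogeneous_nspace.homogeneous_nspace_dual)

section \<open>The concrete spaces\<close>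

lemma homogeneous_nspace_type_space:
  assumes "banach_over s"
  shows "homogeneous_nspace (type_space s)"
  using banach_over.norm_scale[OF assms] by unfold_locales (auto simp: type_space_def)

text \<open>\<open>Bcontfun\<close> is inverted only on bounded continuous functions, so the content
  is that scaling preserves these.\<close>

lemma apply_C_space_scale:
  "apply_bcontfun (Bcontfun (\<lambda>\<omega>. c * apply_bcontfun \<phi> \<omega>)) \<omega> = c * apply_bcontfun \<phi> \<omega>"
  for c :: "'k::rc_field"
proof -
  have "(\<lambda>\<omega>. c * apply_bcontfun \<phi> \<omega>) \<in> bcontfun"
    by (rule bcontfun_normI[where b = "norm c * norm \<phi>"])
       (auto intro!: continuous_intros mult_left_mono norm_bounded simp: norm_mult)
  then show ?thesis by (simp add: Bcontfun_inverse)
qed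

lemma homogeneous_nspace_C_space: "homogeneous_nspace (C_space (*))"
  by unfold_locales
     (auto simp: C_space_def apply_C_space_scale norm_mult intro!: norm_bound mult_left_mono norm_bounded)

subsection \<open>Functions with disjoint supports\<close>

lemma banach_over_scale_zero:
  assumes "banach_over s"
  shows "s 0 x = 0" "s c 0 = 0"
proof -
  interpret banach_over s by fact
  show "s 0 x = 0" "s c 0 = 0" by simp_all
qed

text \<open>Supplies the continuity of scalar multiples of a fixed vector. Compatibility with the
  real structure comes from \<open>scale_of_real\<close>.\<close>

lemma bounded_linear_banach_over:
  assumes "banach_over s"
  shows "bounded_linear (\<lambda>c. s c x)"
proof -
  interpret banach_over s by fact
  show ?thesis
  proof (rule bounded_linear_intro)
    show "s (r *\<^sub>R c) x = r *\<^sub>R s c x" for r c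
      by (simp add: scaleR_conv_of_real scale_of_real flip: scale_scale)
    show "norm (s c x) \<le> norm c * norm x" for c
      by (simp add: norm_scale)
  qed (simp add: scale_left_distrib)
qed

lemma apply_fun_times_vec:
  assumes "banach_over s"
  shows "apply_bcontfun (fun_times_vec s \<phi> x) \<omega> = s (apply_bcontfun \<phi> \<omega>) x"
proof -
  have "(\<lambda>\<omega>. s (apply_bcontfun \<phi> \<omega>) x) \<in> bcontfun"
    by (rule bcontfun_normI[where b = "norm \<phi> * norm x"])
       (auto intro!: bounded_linear.continuous_on[OF bounded_linear_banach_over[OF assms]]
         mult_right_mono norm_bounded simp: banach_over.norm_scale[OF assms])
  then show ?thesis by (simp add: fun_times_vec_def Bcontfun_inverse)
qed

lemma apply_bcontfun_sum:
  "apply_bcontfun (\<Sum>i\<in>A. f i) \<omega> = (\<Sum>i\<in>A. apply_bcontfun (f i) \<omega>)"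
  by (induction A rule: infinite_finite_induct) auto

text \<open>Since the supports are disjoint, at every point the coefficients of the \<open>z i\<close> have at
  most one nonzero entry and hence lie in every \<open>\<ell>\<^sub>q\<close> unit ball.\<close>

lemma disjoint_sum_Cp_witness:
  assumes s: "banach_over s"
    and le: "\<And>i \<omega>. i < n \<Longrightarrow> norm (apply_bcontfun (\<phi> i) \<omega>) \<le> 1"
    and disj: "\<And>i j \<omega>. i < n \<Longrightarrow> j < n \<Longrightarrow> apply_bcontfun (\<phi> i) \<omega> \<noteq> 0 \<Longrightarrow>
      apply_bcontfun (\<phi> j) \<omega> \<noteq> 0 \<Longrightarrow> i = j"
  shows "(\<lambda>i. if i < n then z i else 0) \<in> Cp_witnesses s p (\<Sum>i<n. fun_times_vec s (\<phi> i) (z i))"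
proof -
  let ?z = "\<lambda>i. if i < n then z i else 0"
  have "lp_norm p ?z < \<infinity>"
  proof (cases "p = \<infinity>")
    case True
    have "norm (?z i) \<le> (\<Sum>i<n. norm (z i))" for i
      by (auto intro!: member_le_sum sum_nonneg)
    then have "lp_norm p ?z \<le> ennreal (\<Sum>i<n. norm (z i))"
      using True by (auto simp: lp_norm_def simp del: sum_ennreal intro!: SUP_least ennreal_leI)
    then show ?thesis using ennreal_less_top le_less_trans by (metis infinity_ennreal_def)
  next
    case False
    then show ?thesis by (simp add: lp_norm_finite_support[where n = n])
  qed
  moreover have "?z \<longlonglongrightarrow> 0"
    by (rule tendsto_eventually) (auto simp: eventually_sequentially intro!: exI[of _ n])
  moreover have "apply_bcontfun (\<Sum>i<n. fun_times_vec s (\<phi> i) (z i)) \<omega> \<in> p_hull s p ?z" for \<omega>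
  proof -
    define \<alpha> where "\<alpha> i = (if i < n then apply_bcontfun (\<phi> i) \<omega> else 0)" for i
    have "lp_norm (conj_exp p) \<alpha> \<le> 1"
      by (rule lp_norm_single_term_le_1) (use le disj in \<open>auto simp: \<alpha>_def split: if_splits\<close>)
    moreover have "(\<lambda>i. s (\<alpha> i) (?z i)) sums (\<Sum>i<n. s (\<alpha> i) (?z i))"
      by (rule sums_finite) (auto simp: \<alpha>_def banach_over_scale_zero[OF s])
    moreover have "(\<Sum>i<n. s (\<alpha> i) (?z i)) = apply_bcontfun (\<Sum>i<n. fun_times_vec s (\<phi> i) (z i)) \<omega>"
      by (simp add: \<alpha>_def apply_bcontfun_sum apply_fun_times_vec[OF s])
    ultimately show ?thesis by (auto simp: p_hull_def)
  qed
  ultimately show ?thesis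
    by (auto simp: Cp_witnesses_def p_null_sequences_def)
qed

lemma Cp_norm_le:
  assumes "z \<in> Cp_witnesses s p f" and "lp_norm p z \<le> ennreal b" and "0 \<le> b"
  shows "vnorm (Cp_space s p) f \<le> b"
proof -
  have "(INF x\<in>Cp_witnesses s p f. lp_norm p x) \<le> ennreal b"
    using assms by (meson INF_lower2)
  then show ?thesis
    using assms(3) by (simp add: Cp_space_def enn2real_leI)
qed

text \<open>Additivity of \<open>U\<close> is available only on its carrier, so every partial sum
  has to be p-continuous; disjointness of the supports provides a witness for each of them.\<close>

lemma Cp_operator_disjoint_sum:
  fixes n :: nat
  assumes s: "banach_over s" and U: "U \<in> vset (op_space (Cp_space s p) (type_space sY))"
    and le: "\<And>i \<omega>. i < n \<Longrightarrow> norm (apply_bcontfun (\<phi> i) \<omega>) \<le> 1"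
    and disj: "\<And>i j \<omega>. i < n \<Longrightarrow> j < n \<Longrightarrow> apply_bcontfun (\<phi> i) \<omega> \<noteq> 0 \<Longrightarrow>
      apply_bcontfun (\<phi> j) \<omega> \<noteq> 0 \<Longrightarrow> i = j"
  shows "U (\<Sum>i<n. fun_times_vec s (\<phi> i) (z i)) = (\<Sum>i<n. U (fun_times_vec s (\<phi> i) (z i)))"
proof -
  have add: "U (f + g) = U f + U g"
    if "f \<in> vset (Cp_space s p)" "g \<in> vset (Cp_space s p)" for f g
    using U that by (simp add: op_space_def type_space_def Cp_space_def C_space_def)
  have partial: "(\<Sum>i<m. fun_times_vec s (\<phi> i) (z i)) \<in> vset (Cp_space s p)" if "m \<le> n" for m
    using disjoint_sum_Cp_witness[OF s, where n = m and \<phi> = \<phi> and z = z and p = p] le disj that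
    by (auto simp: Cp_space_def)
  have single: "fun_times_vec s (\<phi> i) (z i) \<in> vset (Cp_space s p)" if "i < n" for i
    \<comment> \<open>A single summand is a disjoint sum of length one.\<close>
    using disjoint_sum_Cp_witness[OF s, where n = 1 and \<phi> = "\<lambda>_. \<phi> i" and z = "\<lambda>_. z i" and p = p]
      le that
    by (auto simp: Cp_space_def)
  have "U (\<Sum>i<m. fun_times_vec s (\<phi> i) (z i)) = (\<Sum>i<m. U (fun_times_vec s (\<phi> i) (z i)))"
    if "m \<le> n" for m
    using that
  proof (induction m)
    case 0
    \<comment> \<open>Additivity at \<open>0 + 0\<close> gives \<open>U 0 = 0\<close>.\<close>
    show ?case using add[of 0 0] partial[of 0] by simp
  next
    case (Suc m)
    then show ?case using add[OF partial single, of m m] by simp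
  qed
  then show ?thesis by simp
qed

section \<open>Urysohn functions and approximation of indicator functions\<close>

text \<open>The sets \<open>G i\<close> may overlap, so Urysohn functions vanishing off
  \<open>G i\<close> need not have disjoint supports. Making each one vanish also on the other
  compact sets, subtracting the other functions and truncating at 0 separates them without changing
  the value 1 on \<open>K i\<close>.\<close>

lemma disjoint_bump_functions:
  fixes K G :: "nat \<Rightarrow> 'o::t2_space set"
  assumes "compact (UNIV :: 'o set)"
    and K: "\<And>i. i < n \<Longrightarrow> compact (K i)" and G: "\<And>i. i < n \<Longrightarrow> open (G i)"
    and KG: "\<And>i. i < n \<Longrightarrow> K i \<subseteq> G i" and disj: "\<And>i j. i < n \<Longrightarrow> j < n \<Longrightarrow> i \<noteq> j \<Longrightarrow> K i \<inter> K j = {}"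
  shows "\<exists>\<phi> :: nat \<Rightarrow> 'o \<Rightarrow> real.
    (\<forall>i<n. continuous_on UNIV (\<phi> i) \<and> (\<forall>\<omega>. \<phi> i \<omega> \<in> {0..1}) \<and> (\<forall>\<omega>\<in>K i. \<phi> i \<omega> = 1) \<and>
      (\<forall>\<omega>. \<omega> \<notin> G i \<longrightarrow> \<phi> i \<omega> = 0)) \<and>
    (\<forall>i<n. \<forall>j<n. \<forall>\<omega>. \<phi> i \<omega> \<noteq> 0 \<longrightarrow> \<phi> j \<omega> \<noteq> 0 \<longrightarrow> i = j)"
proof -
  have normal: "normal_space (euclidean :: 'o topology)"
    using assms(1)
    by (intro compact_Hausdorff_or_regular_imp_normal_space disjI1)
       (auto simp: compact_space_def Hausdorff_space_def disjnt_def dest!: hausdorff)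
  define P where "P i \<psi> \<longleftrightarrow> continuous_on UNIV \<psi> \<and> (\<forall>\<omega>. \<psi> \<omega> \<in> {0..1}) \<and> (\<forall>\<omega>\<in>K i. \<psi> \<omega> = 1) \<and>
      (\<forall>\<omega>. \<omega> \<notin> G i \<longrightarrow> \<psi> \<omega> = 0) \<and> (\<forall>j<n. j \<noteq> i \<longrightarrow> (\<forall>\<omega>\<in>K j. \<psi> \<omega> = 0))"
    for i and \<psi> :: "'o \<Rightarrow> real"
  have "\<exists>\<psi>. P i \<psi>" if i: "i < n" for i
  proof -
    \<comment> \<open>The set on which the \<open>i\<close>-th function must vanish: outside
      \<open>G i\<close> and on all the other compact sets.\<close>
    let ?T = "- G i \<union> (\<Union>j\<in>{..<n} - {i}. K j)"
    have "closed (K j)" if "j < n" for j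
      using K[OF that] by (rule compact_imp_closed)
    then have "closedin euclidean ?T" "closedin euclidean (K i)"
      using G i by (auto intro!: closed_Un closed_UN)
    moreover have "disjnt ?T (K i)"
      using KG[OF i] disj i by (force simp: disjnt_def)
    ultimately obtain \<psi> where \<psi>: "continuous_map euclidean (top_of_set {0..1::real}) \<psi>"
      "\<psi> ` ?T \<subseteq> {0}" "\<psi> ` K i \<subseteq> {1}"
      using Urysohn_lemma[OF normal, of ?T "K i" 0 1] by auto
    then show ?thesis
      unfolding P_def by (intro exI[of _ \<psi>]) (auto simp: continuous_map_in_subtopology image_subset_iff Pi_iff)
  qed
  then obtain \<psi> where "\<And>i. i < n \<Longrightarrow> P i (\<psi> i)" by metis
  then have \<psi>: "\<And>i. i < n \<Longrightarrow> continuous_on UNIV (\<psi> i)" "\<And>i \<omega>. i < n \<Longrightarrow> 0 \<le> \<psi> i \<omega>"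
    "\<And>i \<omega>. i < n \<Longrightarrow> \<psi> i \<omega> \<le> 1"
    "\<And>i \<omega>. i < n \<Longrightarrow> \<omega> \<in> K i \<Longrightarrow> \<psi> i \<omega> = 1" "\<And>i \<omega>. i < n \<Longrightarrow> \<omega> \<notin> G i \<Longrightarrow> \<psi> i \<omega> = 0"
    "\<And>i j \<omega>. i < n \<Longrightarrow> j < n \<Longrightarrow> j \<noteq> i \<Longrightarrow> \<omega> \<in> K j \<Longrightarrow> \<psi> i \<omega> = 0"
    by (simp_all add: P_def)
  let ?S = "\<lambda>i \<omega>. \<Sum>j\<in>{..<n} - {i}. \<psi> j \<omega>"
  define \<phi> where "\<phi> i \<omega> = max 0 (\<psi> i \<omega> - ?S i \<omega>)" for i \<omega>
  have S: "?S i \<omega> \<ge> 0" "i < n \<Longrightarrow> j < n \<Longrightarrow> j \<noteq> i \<Longrightarrow> \<psi> j \<omega> \<le> ?S i \<omega>" for i j \<omega>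
    using \<psi>(2) by (auto intro!: sum_nonneg member_le_sum)
  show ?thesis
  proof (intro exI[of _ \<phi>] conjI allI impI ballI)
    show "continuous_on UNIV (\<phi> i)" if "i < n" for i
      unfolding \<phi>_def using \<psi>(1) that by (auto intro!: continuous_intros)
    show "\<phi> i \<omega> \<in> {0..1}" if "i < n" for i \<omega>
      using S(1)[of \<omega> i] \<psi>(3)[OF that, of \<omega>] by (auto simp: \<phi>_def)
    show "\<phi> i \<omega> = 1" if "i < n" "\<omega> \<in> K i" for i \<omega>
      using \<psi>(4,6) that by (simp add: \<phi>_def)
    show "\<phi> i \<omega> = 0" if "i < n" "\<omega> \<notin> G i" for i \<omega>
      using \<psi>(5) that S(1)[of \<omega> i] by (simp add: \<phi>_def)
    show "i = j" if "i < n" "j < n" "\<phi> i \<omega> \<noteq> 0" "\<phi> j \<omega> \<noteq> 0" for i j \<omega>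
    proof (rule ccontr)
      assume "i \<noteq> j"
      \<comment> \<open>If both were nonzero, then \<open>\<psi> i \<omega>\<close> would exceed
        \<open>?S i \<omega>\<close>, hence \<open>\<psi> j \<omega>\<close>, and by symmetry the
        reverse strict inequality would hold too.\<close>
      then show False
        using S(2)[of i j \<omega>] S(2)[of j i \<omega>] that by (auto simp: \<phi>_def max_def split: if_splits)
    qed
  qed
qed

text \<open>The indicator of \<open>E i\<close> and a bump function for \<open>K i\<close> inside
  \<open>G i\<close> agree on \<open>K i\<close> and off \<open>G i\<close>. Their integrals thus
  differ by at most the variation on \<open>G i - K i\<close>, which regularity makes small.\<close>

lemma representing_measure_bump_approximation:
  fixes \<beta> :: "nat \<Rightarrow> 'k::rc_field" and E :: "nat \<Rightarrow> 'o::t2_space set"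
    and l :: "nat \<Rightarrow> ('o \<Rightarrow>\<^sub>C 'k) \<Rightarrow> 'k"
  assumes compact: "compact (UNIV :: 'o set)"
    and E: "\<And>i. E i \<in> sets borel" and disj: "disjoint_family E"
    and \<xi>: "\<And>i. char_bidual (E i) (\<xi> i)" and l: "\<And>i. l i \<in> vset (dual (C_space (*)))"
    and "0 < \<delta>"
  shows "\<exists>\<Phi> :: nat \<Rightarrow> 'o \<Rightarrow>\<^sub>C 'k.
    (\<forall>i<n. (\<forall>\<omega>. norm (apply_bcontfun (\<Phi> i) \<omega>) \<le> 1) \<and> norm (\<xi> i (l i) - l i (\<Phi> i)) \<le> \<delta>) \<and>
    (\<forall>i<n. \<forall>j<n. \<forall>\<omega>. apply_bcontfun (\<Phi> i) \<omega> \<noteq> 0 \<longrightarrow> apply_bcontfun (\<Phi> j) \<omega> \<noteq> 0 \<longrightarrow> i = j)"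
proof -
  have "\<exists>\<mu>. regular_borel_measure \<mu> \<and> (\<forall>\<phi>. has_measure_integral \<mu> (apply_bcontfun \<phi>) (l i \<phi>)) \<and>
      has_measure_integral \<mu> (indicator (E i)) (\<xi> i (l i))" for i
    using \<xi>[of i] l[of i] by (simp add: char_bidual_def)
  then obtain \<mu> where \<mu>: "\<And>i. regular_borel_measure (\<mu> i)"
    "\<And>i \<phi>. has_measure_integral (\<mu> i) (apply_bcontfun \<phi>) (l i \<phi>)"
    "\<And>i. has_measure_integral (\<mu> i) (indicator (E i)) (\<xi> i (l i))"
    by metis
  \<comment> \<open>Each functional has its own measure, so the sets are chosen separately for each
    index; the compact ones inherit disjointness from the \<open>E i\<close>.\<close>
  have "\<exists>K G. compact K \<and> open G \<and> K \<subseteq> E i \<and> E i \<subseteq> G \<and>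
      total_variation (\<mu> i) (G - K) < ennreal \<delta>" for i
    using \<mu>(1)[of i] E[of i] \<open>0 < \<delta>\<close> by (simp add: regular_borel_measure_def)
  then obtain K G where KG: "\<And>i. compact (K i)" "\<And>i. open (G i)" "\<And>i. K i \<subseteq> E i"
    "\<And>i. E i \<subseteq> G i" "\<And>i. total_variation (\<mu> i) (G i - K i) < ennreal \<delta>"
    by metis
  have K_G: "K i \<subseteq> G i" for i using KG(3,4) by blast
  have K_disj: "K i \<inter> K j = {}" if "i \<noteq> j" for i j
  proof -
    have "E i \<inter> E j = {}" using disj that by (auto simp: disjoint_family_on_def)
    then show ?thesis using KG(3)[of i] KG(3)[of j] by blast
  qed
  obtain \<phi> :: "nat \<Rightarrow> 'o \<Rightarrow> real" where
    "(\<forall>i<n. continuous_on UNIV (\<phi> i) \<and> (\<forall>\<omega>. \<phi> i \<omega> \<in> {0..1}) \<and> (\<forall>\<omega>\<in>K i. \<phi> i \<omega> = 1) \<and>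
      (\<forall>\<omega>. \<omega> \<notin> G i \<longrightarrow> \<phi> i \<omega> = 0)) \<and>
    (\<forall>i<n. \<forall>j<n. \<forall>\<omega>. \<phi> i \<omega> \<noteq> 0 \<longrightarrow> \<phi> j \<omega> \<noteq> 0 \<longrightarrow> i = j)"
    using disjoint_bump_functions[OF compact, of n K G] KG(1,2) K_G K_disj by blast
  then have \<phi>: "\<And>i. i < n \<Longrightarrow> continuous_on UNIV (\<phi> i)" "\<And>i \<omega>. i < n \<Longrightarrow> \<phi> i \<omega> \<in> {0..1}"
    "\<And>i \<omega>. i < n \<Longrightarrow> \<omega> \<in> K i \<Longrightarrow> \<phi> i \<omega> = 1"
    "\<And>i \<omega>. i < n \<Longrightarrow> \<omega> \<notin> G i \<Longrightarrow> \<phi> i \<omega> = 0"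
    "\<And>i j \<omega>. i < n \<Longrightarrow> j < n \<Longrightarrow> \<phi> i \<omega> \<noteq> 0 \<Longrightarrow> \<phi> j \<omega> \<noteq> 0 \<Longrightarrow> i = j"
    by simp_all
  define \<Phi> :: "nat \<Rightarrow> 'o \<Rightarrow>\<^sub>C 'k" where "\<Phi> i = Bcontfun (\<lambda>\<omega>. of_real (\<phi> i \<omega>))" for i
  have \<Phi>: "apply_bcontfun (\<Phi> i) \<omega> = of_real (\<phi> i \<omega>)" if "i < n" for i \<omega>
  proof -
    have "(\<lambda>\<omega>. of_real (\<phi> i \<omega>) :: 'k) \<in> bcontfun"
      by (rule bcontfun_normI[where b = 1]) (use \<phi>(1,2)[OF that] in \<open>auto intro!: continuous_intros\<close>)
    then show ?thesis by (simp add: \<Phi>_def Bcontfun_inverse)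
  qed
  show ?thesis
  proof (intro exI[of _ \<Phi>] conjI allI impI)
    show "norm (apply_bcontfun (\<Phi> i) \<omega>) \<le> 1" if "i < n" for i \<omega>
      using \<phi>(2)[OF that, of \<omega>] by (simp add: \<Phi>[OF that])
    show "i = j" if "i < n" "j < n" "apply_bcontfun (\<Phi> i) \<omega> \<noteq> 0" "apply_bcontfun (\<Phi> j) \<omega> \<noteq> 0"
      for i j \<omega>
      using \<phi>(5)[OF that(1,2), of \<omega>] that by (simp add: \<Phi>)
    show "norm (\<xi> i (l i) - l i (\<Phi> i)) \<le> \<delta>" if "i < n" for i
    proof -
      \<comment> \<open>Both functions become images of real ones, whose difference lies between -1
        and 1.\<close>
      have ind: "indicator (E i) \<omega> = (of_real (indicator (E i) \<omega>) :: 'k)" for \<omega>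
        by (simp add: indicator_def)
      have "norm (\<xi> i (l i) - l i (\<Phi> i)) \<le> enn2real (total_variation (\<mu> i) (G i - K i))"
      proof (rule has_measure_integral_diff_le[OF \<mu>(1) \<mu>(3) \<mu>(2)])
        show "G i - K i \<in> sets borel"
          by (intro sets.Diff borel_open borel_closed compact_imp_closed KG)
        show "norm (indicator (E i) \<omega> - apply_bcontfun (\<Phi> i) \<omega>) \<le> 1" for \<omega>
          unfolding \<Phi>[OF that] ind of_real_diff[symmetric] norm_of_real
          using \<phi>(2)[OF that, of \<omega>] by (auto simp: indicator_def)
        show "indicator (E i) \<omega> = apply_bcontfun (\<Phi> i) \<omega>" if "\<omega> \<notin> G i - K i" for \<omega>
          using that KG(3,4)[of i] \<phi>(3,4)[OF \<open>i < n\<close>, of \<omega>] by (auto simp: \<Phi>[OF \<open>i < n\<close>] indicator_def)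
      qed
      also have "\<dots> \<le> \<delta>"
        using KG(5)[of i] \<open>0 < \<delta>\<close> by (intro enn2real_leI) auto
      finally show ?thesis .
    qed
  qed
qed

section \<open>The uniform bound for the representing measure\<close>

theorem proposition4p2:
  fixes sX :: "'k::rc_field \<Rightarrow> 'x::banach \<Rightarrow> 'x"
    and sY :: "'k \<Rightarrow> 'y::banach \<Rightarrow> 'y"
    and S :: "('o::t2_space \<Rightarrow>\<^sub>C 'k) \<Rightarrow> 'x \<Rightarrow> 'y"
    and m :: "'o set \<Rightarrow> 'x \<Rightarrow> ('y \<Rightarrow> 'k) \<Rightarrow> 'k"
    and p :: ennreal
  assumes "banach_over sX" and "banach_over sY"
    and "compact (UNIV :: 'o set)"
    and "S \<in> vset (op_space (C_space (*)) (op_space (type_space sX) (type_space sY)))"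
    and "representing_measure sY S m"
    and "1 \<le> p"
    and "\<exists>U \<in> vset (op_space (Cp_space sX p) (type_space sY)). assoc_op sX U = S"
  shows "\<exists>c::real. c > 0 \<and>
    (\<forall>E x. (\<forall>i. E i \<in> sets borel) \<and> disjoint_family E \<and> (\<forall>i. norm (x i) \<le> 1) \<longrightarrow>
      weak_lp_norm (conj_exp p) (dual (dual (type_space sY))) (\<lambda>i. m (E i) (x i)) \<le> ennreal c)"
proof -
  let ?C = "C_space (*) :: ('k, 'o \<Rightarrow>\<^sub>C 'k) nspace" and ?X = "type_space sX" and ?Y = "type_space sY"
  interpret X: homogeneous_nspace ?X by (rule homogeneous_nspace_type_space[OF assms(1)])
  interpret Y: homogeneous_nspace ?Y by (rule homogeneous_nspace_type_space[OF assms(2)])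
  interpret dY: homogeneous_nspace "dual ?Y" by (rule Y.homogeneous_nspace_dual)
  interpret ddY: homogeneous_nspace "dual (dual ?Y)" by (rule dY.homogeneous_nspace_dual)
  have C: "homogeneous_nspace ?C" by (rule homogeneous_nspace_C_space)
  obtain U where U: "U \<in> vset (op_space (Cp_space sX p) ?Y)"
    and S_eq: "\<And>\<phi> x. S \<phi> x = U (fun_times_vec sX \<phi> x)"
    using assms(7) by (auto simp: assoc_op_def)
  obtain B where B: "\<And>f. f \<in> vset (Cp_space sX p) \<Longrightarrow> norm (U f) \<le> B * vnorm (Cp_space sX p) f"
    using op_space_bounded[OF U] by (auto simp: type_space_def)

  have S_op: "S \<phi> \<in> vset (op_space ?X ?Y)" for \<phi>
    using op_space_apply[OF assms(4)] by (simp add: C_space_def)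
  have S_scale: "S \<phi> (sX c x) = sY c (S \<phi> x)" for \<phi> c x
    using op_space_scale[OF S_op, of x \<phi> c] by (simp add: type_space_def)
  \<comment> \<open>Boundedness for fixed \<open>x\<close> places the values of the measure in the
    bidual of \<open>Y\<close>.\<close>
  have T: "(\<lambda>\<phi>. S \<phi> x) \<in> vset (op_space ?C ?Y)" for x
  proof -
    obtain M where M: "\<And>\<phi>. vnorm (op_space ?X ?Y) (S \<phi>) \<le> M * norm \<phi>"
      using op_space_bounded[OF assms(4)] by (auto simp: C_space_def)
    have "norm (S \<phi> x) \<le> (M * norm x) * norm \<phi>" for \<phi>
    proof -
      have "norm (S \<phi> x) \<le> vnorm (op_space ?X ?Y) (S \<phi>) * norm x"
        using X.op_norm_bound[OF S_op, of x \<phi>] banach_over.norm_scale[OF assms(2)]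
        by (simp add: type_space_def)
      also have "\<dots> \<le> (M * norm \<phi>) * norm x"
        using M by (rule mult_right_mono) simp
      finally show ?thesis by (simp add: mult_ac)
    qed
    then have "\<exists>B. \<forall>\<phi>. norm (S \<phi> x) \<le> B * norm \<phi>" by blast
    moreover have "S (\<phi> + \<psi>) x = S \<phi> x + S \<psi> x"
      "S (vscale ?C c \<phi>) x = sY c (S \<phi> x)" for \<phi> \<psi> c
      using op_space_add[OF assms(4), of \<phi> \<psi>] op_space_scale[OF assms(4), of \<phi> c]
      by (simp_all add: vadd_op_space vscale_op_space C_space_def type_space_def)
    ultimately show ?thesis
      by (auto simp: op_space_def type_space_def C_space_def)
  qed
  have m: "\<exists>\<xi>. char_bidual E \<xi> \<and> m E x = biadjoint_op ?C ?Y (\<lambda>\<phi>. S \<phi> x) \<xi>"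
    if "E \<in> sets borel" for E x
    using assms(5) that by (simp add: representing_measure_def classical_representing_measure_def)

  \<comment> \<open>The bound is uniform in all data: \<bar>B\<bar> comes from \<open>U\<close> on
    the unit ball, and 1 absorbs the approximation error and makes the final constant
    positive.\<close>
  have key: "norm (\<Sum>i<n. \<beta> i * m (E i) (x i) y) \<le> \<bar>B\<bar> + 1"
    if E: "\<And>i. E i \<in> sets borel" "disjoint_family E" and x: "\<And>i. norm (x i) \<le> 1"
      and \<beta>: "lp_norm p \<beta> \<le> 1" and y: "y \<in> unit_ball (dual ?Y)"
    for E :: "nat \<Rightarrow> 'o set" and x and y and \<beta> :: "nat \<Rightarrow> 'k" and n
  proof -
    have y_dual: "y \<in> vset (dual ?Y)" using y by (simp add: unit_ball_def)
    have y_add: "y (v + w) = y v + y w" and y_scale: "y (sY c v) = c * y v" for v w c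
      using y_dual by (auto simp: vset_dual_iff type_space_def)
    have y_sum: "y (\<Sum>i<n. v i) = (\<Sum>i<n. y (v i))" for v and n :: nat
      by (rule additive.sum) (simp add: Modules.additive_def y_add)
    define l where "l i = adjoint_op ?C ?Y (\<lambda>\<phi>. S \<phi> (x i)) y" for i
    have l: "l i \<in> vset (dual ?C)" for i
      unfolding l_def by (intro adjoint_op_in_dual C Y.homogeneous_nspace_axioms T y_dual)
    have l_eq: "l i \<phi> = y (S \<phi> (x i))" for i \<phi>
      using y_dual by (simp add: l_def adjoint_op_def C_space_def)
    have "\<forall>i. \<exists>\<xi>. char_bidual (E i) \<xi> \<and> m (E i) (x i) = biadjoint_op ?C ?Y (\<lambda>\<phi>. S \<phi> (x i)) \<xi>"
      using m E(1) by blast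
    then obtain \<xi> where \<xi>: "\<And>i. char_bidual (E i) (\<xi> i)"
      and m_eq: "\<And>i. m (E i) (x i) = biadjoint_op ?C ?Y (\<lambda>\<phi>. S \<phi> (x i)) (\<xi> i)"
      by metis
    \<comment> \<open>The biadjoint evaluated at \<open>y\<close> is \<open>\<xi> i\<close>
      evaluated at the adjoint applied to \<open>y\<close>.\<close>
    have m_\<xi>: "m (E i) (x i) y = \<xi> i (l i)" for i
      using \<xi>[of i] y_dual
      by (simp add: m_eq biadjoint_op_def char_bidual_def adjoint_op_def[of "dual ?Y"] l_def)
    let ?b = "\<Sum>i<n. norm (\<beta> i)"
    \<comment> \<open>Chosen so that the weighted errors add up to at most 1; the summand 1 in the
      denominator covers the case of vanishing coefficients.\<close>
    define \<delta> where "\<delta> = 1 / (1 + ?b)"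
    have b: "?b \<ge> 0" by (simp add: sum_nonneg)
    then have \<delta>: "\<delta> > 0" "?b * \<delta> \<le> 1" by (auto simp: \<delta>_def divide_simps)
    obtain \<Phi> where
      "\<forall>i<n. (\<forall>\<omega>. norm (apply_bcontfun (\<Phi> i) \<omega>) \<le> 1) \<and> norm (\<xi> i (l i) - l i (\<Phi> i)) \<le> \<delta>"
      "\<forall>i<n. \<forall>j<n. \<forall>\<omega>. apply_bcontfun (\<Phi> i) \<omega> \<noteq> 0 \<longrightarrow> apply_bcontfun (\<Phi> j) \<omega> \<noteq> 0 \<longrightarrow> i = j"
      using representing_measure_bump_approximation[where l = l and n = n, OF assms(3) E \<xi> l \<delta>(1)]
      by (elim exE conjE)
    then have \<Phi>:
      "\<And>i \<omega>. i < n \<Longrightarrow> norm (apply_bcontfun (\<Phi> i) \<omega>) \<le> 1"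
      "\<And>i j \<omega>. i < n \<Longrightarrow> j < n \<Longrightarrow> apply_bcontfun (\<Phi> i) \<omega> \<noteq> 0 \<Longrightarrow>
        apply_bcontfun (\<Phi> j) \<omega> \<noteq> 0 \<Longrightarrow> i = j"
      and \<Phi>_approx: "\<And>i. i < n \<Longrightarrow> norm (\<xi> i (l i) - l i (\<Phi> i)) \<le> \<delta>"
      by simp_all
    \<comment> \<open>The coefficients are absorbed into the vectors: the scalar functions stay
      bounded by 1, while the witness sequence inherits the norm bound of \<beta>.\<close>
    define f where "f = (\<Sum>i<n. fun_times_vec sX (\<Phi> i) (sX (\<beta> i) (x i)))"
    let ?z = "\<lambda>i. if i < n then sX (\<beta> i) (x i) else 0"
    have f: "?z \<in> Cp_witnesses sX p f"
      unfolding f_def by (rule disjoint_sum_Cp_witness[OF assms(1)]) (use \<Phi> in auto)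
    have "norm (?z i) \<le> norm (\<beta> i)" for i
      using x[of i] by (simp add: banach_over.norm_scale[OF assms(1)] mult_left_le)
    then have "lp_norm p ?z \<le> ennreal 1"
      using lp_norm_mono[of ?z \<beta> p] \<beta> by simp
    then have f_norm: "vnorm (Cp_space sX p) f \<le> 1"
      using Cp_norm_le[OF f] by simp
    have f_Cp: "f \<in> vset (Cp_space sX p)"
      using f by (auto simp: Cp_space_def)
    have "U f = (\<Sum>i<n. S (\<Phi> i) (sX (\<beta> i) (x i)))"
      unfolding f_def S_eq by (rule Cp_operator_disjoint_sum[OF assms(1) U]) (use \<Phi> in auto)
    then have "(\<Sum>i<n. \<beta> i * l i (\<Phi> i)) = y (U f)"
      by (simp add: y_sum l_eq S_scale y_scale)
    also have "norm \<dots> \<le> norm (U f)"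
      using Y.dual_unit_ball_bound[OF y, of "U f"] by (simp add: type_space_def)
    also have "\<dots> \<le> B * vnorm (Cp_space sX p) f"
      using B f_Cp by blast
    also have "\<dots> \<le> \<bar>B\<bar> * 1"
      using f_norm by (intro mult_mono) (auto simp: Cp_space_def)
    finally have 1: "norm (\<Sum>i<n. \<beta> i * l i (\<Phi> i)) \<le> \<bar>B\<bar>" by simp
    have "norm (\<Sum>i<n. \<beta> i * (\<xi> i (l i) - l i (\<Phi> i))) \<le> (\<Sum>i<n. norm (\<beta> i) * \<delta>)"
      by (intro sum_norm_le) (auto simp: norm_mult intro!: mult_left_mono \<Phi>_approx)
    also have "\<dots> \<le> 1" using \<delta>(2) by (simp add: sum_distrib_right)
    finally have 2: "norm (\<Sum>i<n. \<beta> i * (\<xi> i (l i) - l i (\<Phi> i))) \<le> 1" .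
    have "(\<Sum>i<n. \<beta> i * m (E i) (x i) y) =
        (\<Sum>i<n. \<beta> i * l i (\<Phi> i)) + (\<Sum>i<n. \<beta> i * (\<xi> i (l i) - l i (\<Phi> i)))"
      by (simp add: m_\<xi> algebra_simps flip: sum.distrib)
    then show ?thesis
      using norm_triangle_mono[OF 1 2] by simp
  qed

  show ?thesis
  proof (intro exI[of _ "\<bar>B\<bar> + 1"] conjI allI impI)
    fix E :: "nat \<Rightarrow> 'o set" and x :: "nat \<Rightarrow> 'x"
    assume "(\<forall>i. E i \<in> sets borel) \<and> disjoint_family E \<and> (\<forall>i. norm (x i) \<le> 1)"
    then have E: "\<And>i. E i \<in> sets borel" "disjoint_family E" and x: "\<And>i. norm (x i) \<le> 1"
      by auto
    have bidual: "m (E i) (x i) \<in> vset (dual (dual ?Y))" for i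
    proof -
      obtain \<xi> where "char_bidual (E i) \<xi>" "m (E i) (x i) = biadjoint_op ?C ?Y (\<lambda>\<phi>. S \<phi> (x i)) \<xi>"
        using m E(1) by blast
      then show ?thesis
        using biadjoint_op_in_bidual[OF C Y.homogeneous_nspace_axioms T] by (simp add: char_bidual_def)
    qed
    show "weak_lp_norm (conj_exp p) (dual (dual ?Y)) (\<lambda>i. m (E i) (x i)) \<le> ennreal (\<bar>B\<bar> + 1)"
      unfolding weak_lp_norm_def
    proof (intro SUP_least lp_norm_conj_exp_le)
      fix f n and \<beta> :: "nat \<Rightarrow> 'k"
      assume f: "f \<in> unit_ball (dual (dual (dual ?Y)))" and \<beta>: "lp_norm p \<beta> \<le> 1"
      \<comment> \<open>The weak norm tests against the third dual of \<open>Y\<close>, but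
        \<open>key\<close> only against its dual. The combination is one element of the bidual, and
        its norm is a supremum over the dual unit ball, where \<open>key\<close> applies.\<close>
      let ?g = "\<lambda>y\<in>vset (dual ?Y). \<Sum>i<n. \<beta> i * m (E i) (x i) y"
      have g: "?g \<in> vset (dual (dual ?Y))" "f ?g = (\<Sum>i<n. \<beta> i * f (m (E i) (x i)))"
        using dY.dual_linear_combination[where \<xi> = "\<lambda>i. m (E i) (x i)" and f = f and n = n and \<beta> = \<beta>]
          bidual f
        by (auto simp: unit_ball_def)
      have "norm (f ?g) \<le> vnorm (dual (dual ?Y)) ?g"
        using f g(1) by (rule ddY.dual_unit_ball_bound)
      also have "\<dots> \<le> \<bar>B\<bar> + 1"
      proof (rule dY.vnorm_dual_le)
        fix y assume y: "y \<in> unit_ball (dual ?Y)"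
        then show "norm (?g y) \<le> \<bar>B\<bar> + 1"
          using key[OF E x \<beta> y] by (simp add: unit_ball_def)
      qed
      finally show "norm (\<Sum>i<n. \<beta> i * f (m (E i) (x i))) \<le> \<bar>B\<bar> + 1"
        by (simp only: g(2))
    qed (use assms(6) in auto)
  qed simp
qed

end
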